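(* Let $\mathcal{G}$ be a connected groupoid whose object set $\mathcal{G}_0$ is finite, let $x\in\mathcal{G}_0$, and let $\alpha=(A_g,\alpha_g)_{g\in\mathcal{G}}$ be a unital partial action of $\mathcal{G}$ on a ring $A=\bigoplus_{y\in\mathcal{G}_0}A_y$. Suppose $\alpha$ is group-type, and let $\tau(x)=\{\tau_y : y\in\mathcal{G}_0\}$ be a transversal for $x$ with $A_{\tau_y^{-1}}=A_x$ and $A_{\tau_y}=A_y$ for all $y\in\mathcal{G}_0$. Let $\beta$ be the global action of the coarse groupoid $\mathcal{G}_0^2$ on $A$ and $\gamma$ the unital partial action of the isotropy group $\mathcal{G}(x)$ on $A\star_\beta\mathcal{G}_0^2$ defined in the context. Then there is a ring isomorphism $$A\star_\alpha\mathcal{G}\;\simeq\;(A\star_\beta\mathcal{G}_0^2)\star_\gamma\mathcal{G}(x).$$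
   Context: Rings are associative, not necessarily unital. A groupoid is a small category in which every morphism is invertible; for $g:x\to y$ write $s(g)=x$, $t(g)=y$; objects are identified with their identity morphisms; $gh$ is defined iff $s(g)=t(h)$. The isotropy group is $\mathcal{G}(x)=\{g : s(g)=t(g)=x\}$. $\mathcal{G}$ is connected if any two objects are joined by a morphism. The coarse groupoid $\mathcal{G}_0^2=\mathcal{G}_0\times\mathcal{G}_0$ has $s(y,z)=y$, $t(y,z)=z$ and $(y,z)(w,y)=(w,z)$ (its objects are the elements of $\mathcal{G}_0$, with identities $(y,y)$). A partial action of $\mathcal{G}$ on a ring $A$ is a family $\alpha=(A_g,\alpha_g)_{g\in\mathcal{G}}$ such that: (i) $A_g$ is an ideal of $A_{t(g)}$ and $A_{t(g)}$ is an ideal of $A$ for all $g$; (ii) $\alpha_g:A_{g^{-1}}\to A_g$ is a ring isomorphism; (iii) $\alpha_y=\mathrm{id}_{A_y}$ for each object $y$; (iv) $\alpha_{gh}$ extends $\alpha_g\alpha_h$ (defined on $\alpha_h^{-1}(A_{g^{-1}}\cap A_h)$) whenever $s(g)=t(h)$. It is global if $\alpha_g\alpha_h=\alpha_{gh}$ whenever $s(g)=t(h)$, and unital if for each $g$ there is a central idempotent $1_g$ of $A$ with $A_g=A1_g$. A group is viewed as a groupoid with one object. A transversal for $x$ is a family $\tau(x)=\{\tau_y\}_{y\in\mathcal{G}_0}$ of morphisms $\tau_y:x\to y$ with $\tau_x=x$. A partial action $\alpha$ of a connected groupoid is group-type if for some object $x$ there is a transversal $\{\tau_y\}$ for $x$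 with $A_{\tau_y^{-1}}=A_x$ and $A_{\tau_y}=A_y$ for all $y$ (this does not depend on the choice of $x$). For a unital partial action, the partial skew groupoid ring $A\star_\alpha\mathcal{G}$ is the set of finite formal sums $\sum_g a_g\delta_g$, $a_g\in A_g$, with componentwise addition and $(a_g\delta_g)(a_h\delta_h)=a_g\alpha_g(a_h1_{g^{-1}})\delta_{gh}$ if $s(g)=t(h)$ and $0$ otherwise. (For a group it is called the partial skew group ring.) Actions $\beta$ and $\gamma$: $\beta=(B_u,\beta_u)_{u\in\mathcal{G}_0^2}$ with $B_u=A_{t(u)}$, $\beta_u=\alpha_{\tau_{t(u)}}\alpha_{\tau_{s(u)}^{-1}}$. Put $C=A\star_\beta\mathcal{G}_0^2$. For $h\in\mathcal{G}(x)$, let $C_h=\bigoplus_{u\in\mathcal{G}_0^2}\alpha_{\tau_{t(u)}}(A_h)\delta_u$, and let $\gamma_h:C_{h^{-1}}\to C_h$ be the additive map with $\gamma_h(\alpha_{\tau_{t(u)}}(a)\delta_u)=\alpha_{\tau_{t(u)}}(\alpha_h(a))\delta_u$ for $a\in A_{h^{-1}}$, $u\in\mathcal{G}_0^2$. Then $\gamma=(C_h,\gamma_h)_{h\in\mathcal{G}(x)}$. *)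

theory Defs
  imports "HOL-Algebra.Ring" "HOL-Algebra.AbelCoset"
begin

section \<open>Rings without unit\<close>

text \<open>
  Rings are associative and not necessarily unital.  The record type of HOL-Algebra rings is
  reused, but its field \<open>one\<close> is ignored throughout: nothing is assumed about it, and
  homomorphisms need not preserve it.
\<close>

locale nonunital_ring = abelian_group R for R (structure) +
  assumes m_closed: "\<lbrakk>a \<in> carrier R; b \<in> carrier R\<rbrakk> \<Longrightarrow> a \<otimes> b \<in> carrier R"
    and m_assoc: "\<lbrakk>a \<in> carrier R; b \<in> carrier R; c \<in> carrier R\<rbrakk> \<Longrightarrow> (a \<otimes> b) \<otimes> c = a \<otimes> (b \<otimes> c)"
    and l_distr: "\<lbrakk>a \<in> carrier R; b \<in> carrier R; c \<in> carrier R\<rbrakk> \<Longrightarrow> (a \<oplus> b) \<otimes> c = a \<otimes> c \<oplus> b \<otimes> c"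
    and r_distr: "\<lbrakk>a \<in> carrier R; b \<in> carrier R; c \<in> carrier R\<rbrakk> \<Longrightarrow> c \<otimes> (a \<oplus> b) = c \<otimes> a \<oplus> c \<otimes> b"

locale nonunital_ideal = additive_subgroup I R for I and R (structure) +
  assumes l_closed: "\<lbrakk>a \<in> I; r \<in> carrier R\<rbrakk> \<Longrightarrow> r \<otimes> a \<in> I"
    and r_closed: "\<lbrakk>a \<in> I; r \<in> carrier R\<rbrakk> \<Longrightarrow> a \<otimes> r \<in> I"

definition nonunital_ring_iso :: "('a, 'm) ring_scheme \<Rightarrow> ('b, 'n) ring_scheme \<Rightarrow> ('a \<Rightarrow> 'b) set" where
  "nonunital_ring_iso R S = iso (add_monoid R) (add_monoid S) \<inter> hom R S"

definition nonunital_ring_isomorphic :: "('a, 'm) ring_scheme \<Rightarrow> ('b, 'n) ring_scheme \<Rightarrow> bool" where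
  "nonunital_ring_isomorphic R S \<longleftrightarrow>
     nonunital_ring R \<and> nonunital_ring S \<and> nonunital_ring_iso R S \<noteq> {}"

definition internal_direct_sum :: "('a, 'm) ring_scheme \<Rightarrow> 'i set \<Rightarrow> ('i \<Rightarrow> 'a set) \<Rightarrow> bool" where
  "internal_direct_sum R I D \<longleftrightarrow>
     (\<forall>a\<in>carrier R. \<exists>!f. f \<in> (\<Pi>\<^sub>E i\<in>I. D i) \<and> a = (\<Oplus>\<^bsub>R\<^esub>i\<in>I. f i))"
  \<comment> \<open>for a finite index set \<open>I\<close> and additive subgroups \<open>D i\<close> of \<open>R\<close>\<close>

definition central_idempotent :: "('a, 'm) ring_scheme \<Rightarrow> 'a \<Rightarrow> bool" where
  "central_idempotent R e \<longleftrightarrow>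
     e \<in> carrier R \<and> e \<otimes>\<^bsub>R\<^esub> e = e \<and> (\<forall>a\<in>carrier R. a \<otimes>\<^bsub>R\<^esub> e = e \<otimes>\<^bsub>R\<^esub> a)"

definition generated_by_idempotent :: "('a, 'm) ring_scheme \<Rightarrow> 'a set \<Rightarrow> 'a \<Rightarrow> bool" where
  "generated_by_idempotent R I e \<longleftrightarrow>
     central_idempotent R e \<and> I = (\<lambda>a. a \<otimes>\<^bsub>R\<^esub> e) ` carrier R"

definition ideal_unit :: "('a, 'm) ring_scheme \<Rightarrow> 'a set \<Rightarrow> 'a" where
  "ideal_unit R I = (THE e. generated_by_idempotent R I e)"

lemma generated_by_idempotent_unique:
  assumes e: "generated_by_idempotent R I e" and f: "generated_by_idempotent R I f"
    and R: "nonunital_ring R"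
  shows "e = f"
proof -
  interpret nonunital_ring R by (rule R)
  have absorb: "u \<otimes>\<^bsub>R\<^esub> v = u"
    if u: "generated_by_idempotent R I u" and v: "generated_by_idempotent R I v" for u v
  proof -
    have uC: "u \<in> carrier R" "u \<otimes>\<^bsub>R\<^esub> u = u" and vC: "v \<in> carrier R" "v \<otimes>\<^bsub>R\<^esub> v = v"
      using u v unfolding generated_by_idempotent_def central_idempotent_def by blast+
    have "u \<in> I" using u uC unfolding generated_by_idempotent_def by force
    then obtain a where "a \<in> carrier R" "u = a \<otimes>\<^bsub>R\<^esub> v"
      using v unfolding generated_by_idempotent_def by blast
    then show ?thesis using vC by (simp add: m_assoc)
  qed
  have "e \<otimes>\<^bsub>R\<^esub> f = f \<otimes>\<^bsub>R\<^esub> e"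
    using e f unfolding generated_by_idempotent_def central_idempotent_def by blast
  then show ?thesis using absorb[OF e f] absorb[OF f e] by metis
qed

lemma ideal_unit_eqI:
  assumes "nonunital_ring R" and "generated_by_idempotent R I e"
  shows "ideal_unit R I = e"
  unfolding ideal_unit_def
proof (rule the_equality)
  show "generated_by_idempotent R I e" by (rule assms(2))
next
  fix f assume "generated_by_idempotent R I f"
  then show "f = e" using assms generated_by_idempotent_unique by metis
qed


section \<open>Groupoids\<close>

text \<open>
  Objects are identified with their identity morphisms, so source and target are themselves
  morphisms.  The product \<open>g \<cdot> h\<close> is meaningful only if \<open>src G g = tgt G h\<close>.
\<close>

record 'g groupoid =
  mor :: "'g set"
  src :: "'g \<Rightarrow> 'g"
  tgt :: "'g \<Rightarrow> 'g"
  cmp :: "'g \<Rightarrow> 'g \<Rightarrow> 'g"  (infixl \<open>\<cdot>\<index>\<close> 70)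

locale groupoid =
  fixes G :: "('g, 'm) groupoid_scheme" (structure)
  assumes src_closed: "g \<in> mor G \<Longrightarrow> src G g \<in> mor G"
    and tgt_closed: "g \<in> mor G \<Longrightarrow> tgt G g \<in> mor G"
    and src_src: "g \<in> mor G \<Longrightarrow> src G (src G g) = src G g"
    and tgt_src: "g \<in> mor G \<Longrightarrow> tgt G (src G g) = src G g"
    and src_tgt: "g \<in> mor G \<Longrightarrow> src G (tgt G g) = tgt G g"
    and tgt_tgt: "g \<in> mor G \<Longrightarrow> tgt G (tgt G g) = tgt G g"
    and cmp_closed: "\<lbrakk>g \<in> mor G; h \<in> mor G; src G g = tgt G h\<rbrakk> \<Longrightarrow> g \<cdot> h \<in> mor G"
    and src_cmp: "\<lbrakk>g \<in> mor G; h \<in> mor G; src G g = tgt G h\<rbrakk> \<Longrightarrow> src G (g \<cdot> h) = src G h"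
    and tgt_cmp: "\<lbrakk>g \<in> mor G; h \<in> mor G; src G g = tgt G h\<rbrakk> \<Longrightarrow> tgt G (g \<cdot> h) = tgt G g"
    and cmp_assoc: "\<lbrakk>g \<in> mor G; h \<in> mor G; k \<in> mor G; src G g = tgt G h; src G h = tgt G k\<rbrakk>
          \<Longrightarrow> (g \<cdot> h) \<cdot> k = g \<cdot> (h \<cdot> k)"
    and cmp_src: "g \<in> mor G \<Longrightarrow> g \<cdot> src G g = g"
    and tgt_cmp_id: "g \<in> mor G \<Longrightarrow> tgt G g \<cdot> g = g"
    and invertible: "g \<in> mor G \<Longrightarrow>
          \<exists>h\<in>mor G. src G h = tgt G g \<and> tgt G h = src G g \<and> g \<cdot> h = tgt G g \<and> h \<cdot> g = src G g"

definition objects :: "('g, 'm) groupoid_scheme \<Rightarrow> 'g set" where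
  "objects G = src G ` mor G"

definition ginv :: "('g, 'm) groupoid_scheme \<Rightarrow> 'g \<Rightarrow> 'g" where
  "ginv G g = (THE h. h \<in> mor G \<and> src G h = tgt G g \<and> tgt G h = src G g \<and>
     g \<cdot>\<^bsub>G\<^esub> h = tgt G g \<and> h \<cdot>\<^bsub>G\<^esub> g = src G g)"

lemma (in groupoid) ginv_eqI:
  assumes "g \<in> mor G" "h \<in> mor G" "src G h = tgt G g" "tgt G h = src G g"
    "g \<cdot> h = tgt G g" "h \<cdot> g = src G g"
  shows "ginv G g = h"
  unfolding ginv_def
proof (rule the_equality)
  show "h \<in> mor G \<and> src G h = tgt G g \<and> tgt G h = src G g \<and> g \<cdot> h = tgt G g \<and> h \<cdot> g = src G g"
    using assms by simp
next
  fix k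
  assume k: "k \<in> mor G \<and> src G k = tgt G g \<and> tgt G k = src G g \<and> g \<cdot> k = tgt G g \<and> k \<cdot> g = src G g"
  then have "k = (h \<cdot> g) \<cdot> k" using assms tgt_cmp_id[of k] by metis
  also have "\<dots> = h \<cdot> (g \<cdot> k)" using k assms cmp_assoc[of h g k] by metis
  also have "\<dots> = h" using k assms cmp_src[of h] by metis
  finally show "k = h" .
qed

definition connected_groupoid :: "('g, 'm) groupoid_scheme \<Rightarrow> bool" where
  "connected_groupoid G \<longleftrightarrow>
     groupoid G \<and> (\<forall>y\<in>objects G. \<forall>z\<in>objects G. \<exists>g\<in>mor G. src G g = y \<and> tgt G g = z)"

definition isotropy :: "('g, 'm) groupoid_scheme \<Rightarrow> 'g \<Rightarrow> 'g groupoid" where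
  "isotropy G x = \<lparr>mor = {g \<in> mor G. src G g = x \<and> tgt G g = x},
     src = src G, tgt = tgt G, cmp = cmp G\<rparr>"
  \<comment> \<open>the group at \<open>x\<close>, viewed as a groupoid with the single object \<open>x\<close>\<close>

definition coarse :: "('g, 'm) groupoid_scheme \<Rightarrow> ('g \<times> 'g) groupoid" where
  "coarse G = \<lparr>mor = objects G \<times> objects G,
     src = (\<lambda>u. (fst u, fst u)), tgt = (\<lambda>u. (snd u, snd u)),
     cmp = (\<lambda>u v. (fst v, snd u))\<rparr>"
  \<comment> \<open>\<open>(y, z)\<close> is the morphism from \<open>y\<close> to \<open>z\<close>; the object \<open>y\<close> becomes its identity \<open>(y, y)\<close>\<close>

lemma groupoid_coarse: "groupoid (coarse G)"
  by unfold_locales (auto simp: coarse_def)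

lemma groupoid_isotropy:
  assumes "groupoid G" and "x \<in> objects G"
  shows "groupoid (isotropy G x)"
proof -
  interpret groupoid G by (rule assms(1))
  have x: "x \<in> mor G" "src G x = x" "tgt G x = x"
    using assms(2) by (auto simp: objects_def src_closed src_src tgt_src)
  show ?thesis
  proof
    fix g assume g: "g \<in> mor (isotropy G x)"
    then show "\<exists>h\<in>mor (isotropy G x). src (isotropy G x) h = tgt (isotropy G x) g \<and>
        tgt (isotropy G x) h = src (isotropy G x) g \<and>
        g \<cdot>\<^bsub>isotropy G x\<^esub> h = tgt (isotropy G x) g \<and> h \<cdot>\<^bsub>isotropy G x\<^esub> g = src (isotropy G x) g"
      using invertible[of g] by (auto simp: isotropy_def)
  next
    fix g assume "g \<in> mor (isotropy G x)"
    then show "g \<cdot>\<^bsub>isotropy G x\<^esub> src (isotropy G x) g = g"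
      using cmp_src[of g] by (simp add: isotropy_def)
  next
    fix g assume "g \<in> mor (isotropy G x)"
    then show "tgt (isotropy G x) g \<cdot>\<^bsub>isotropy G x\<^esub> g = g"
      using tgt_cmp_id[of g] by (simp add: isotropy_def)
  qed (use x in \<open>simp_all add: isotropy_def cmp_closed src_cmp tgt_cmp cmp_assoc\<close>)
qed


section \<open>Partial actions\<close>

text \<open>
  A partial action is given by its domains \<open>D g\<close>, ideals of \<open>A\<close>, and its maps \<open>\<alpha> g\<close>; only the
  values of \<open>\<alpha> g\<close> on \<open>D (ginv G g)\<close> are relevant.
\<close>

locale partial_action = groupoid G + nonunital_ring A
  for G :: "('g, 'm) groupoid_scheme" (structure) and A :: "('a, 'n) ring_scheme" (structure)
    and D :: "'g \<Rightarrow> 'a set" and \<alpha> :: "'g \<Rightarrow> 'a \<Rightarrow> 'a" +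
  assumes ideal_tgt: "g \<in> mor G \<Longrightarrow> nonunital_ideal (D g) (A\<lparr>carrier := D (tgt G g)\<rparr>)"
    and ideal_object: "g \<in> mor G \<Longrightarrow> nonunital_ideal (D (tgt G g)) A"
    and act_iso: "g \<in> mor G \<Longrightarrow>
          \<alpha> g \<in> nonunital_ring_iso (A\<lparr>carrier := D (ginv G g)\<rparr>) (A\<lparr>carrier := D g\<rparr>)"
    and act_object: "\<lbrakk>y \<in> objects G; a \<in> D y\<rbrakk> \<Longrightarrow> \<alpha> y a = a"
    and act_cmp: "\<lbrakk>g \<in> mor G; h \<in> mor G; src G g = tgt G h;
          a \<in> D (ginv G h); \<alpha> h a \<in> D (ginv G g)\<rbrakk>
          \<Longrightarrow> a \<in> D (ginv G (g \<cdot>\<^bsub>G\<^esub> h)) \<and> \<alpha> (g \<cdot>\<^bsub>G\<^esub> h) a = \<alpha> g (\<alpha> h a)"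

locale unital_partial_action = partial_action +
  assumes unital: "g \<in> mor G \<Longrightarrow> \<exists>e. generated_by_idempotent A (D g) e"

definition transversal :: "('g, 'm) groupoid_scheme \<Rightarrow> 'g \<Rightarrow> ('g \<Rightarrow> 'g) \<Rightarrow> bool" where
  "transversal G x \<tau> \<longleftrightarrow>
     (\<forall>y\<in>objects G. \<tau> y \<in> mor G \<and> src G (\<tau> y) = x \<and> tgt G (\<tau> y) = y) \<and> \<tau> x = x"

definition full_transversal ::
  "('g, 'm) groupoid_scheme \<Rightarrow> ('g \<Rightarrow> 'a set) \<Rightarrow> 'g \<Rightarrow> ('g \<Rightarrow> 'g) \<Rightarrow> bool" where
  "full_transversal G D x \<tau> \<longleftrightarrow>
     transversal G x \<tau> \<and> (\<forall>y\<in>objects G. D (ginv G (\<tau> y)) = D x \<and> D (\<tau> y) = D y)"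

definition group_type :: "('g, 'm) groupoid_scheme \<Rightarrow> ('g \<Rightarrow> 'a set) \<Rightarrow> bool" where
  "group_type G D \<longleftrightarrow> (\<exists>x\<in>objects G. \<exists>\<tau>. full_transversal G D x \<tau>)"


section \<open>Partial skew groupoid rings\<close>

text \<open>
  The formal sum \<open>\<Sum>g. a g \<delta>\<^sub>g\<close> is represented by its coefficient function \<open>a\<close>, which is zero
  outside \<open>mor G\<close>.  In general this ring has no identity, so the field \<open>one\<close> is left undefined.
\<close>

definition skew_groupoid_ring ::
  "('g, 'm) groupoid_scheme \<Rightarrow> ('a, 'n) ring_scheme \<Rightarrow> ('g \<Rightarrow> 'a set) \<Rightarrow> ('g \<Rightarrow> 'a \<Rightarrow> 'a) \<Rightarrow> ('g \<Rightarrow> 'a) ring"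
where
  "skew_groupoid_ring G A D \<alpha> =
     \<lparr>carrier = {a. (\<forall>g\<in>mor G. a g \<in> D g) \<and> (\<forall>g. g \<notin> mor G \<longrightarrow> a g = \<zero>\<^bsub>A\<^esub>) \<and> finite {g. a g \<noteq> \<zero>\<^bsub>A\<^esub>}},
      mult = (\<lambda>a b k. finsum A (\<lambda>(g, h). a g \<otimes>\<^bsub>A\<^esub> \<alpha> g (b h \<otimes>\<^bsub>A\<^esub> ideal_unit A (D (ginv G g))))
                {(g, h). g \<in> mor G \<and> h \<in> mor G \<and> a g \<noteq> \<zero>\<^bsub>A\<^esub> \<and> b h \<noteq> \<zero>\<^bsub>A\<^esub> \<and>
                         src G g = tgt G h \<and> g \<cdot>\<^bsub>G\<^esub> h = k}),
      one = undefined,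
      zero = (\<lambda>g. \<zero>\<^bsub>A\<^esub>),
      add = (\<lambda>a b g. a g \<oplus>\<^bsub>A\<^esub> b g)\<rparr>"


section \<open>The actions \<open>\<beta>\<close> and \<open>\<gamma>\<close>\<close>

text \<open>
  The target of \<open>u\<close> in the coarse groupoid is the identity at \<open>snd u\<close>, its source the one at
  \<open>fst u\<close>.
\<close>

definition beta_dom :: "('g \<Rightarrow> 'a set) \<Rightarrow> 'g \<times> 'g \<Rightarrow> 'a set" where
  "beta_dom D u = D (snd u)"

definition beta ::
  "('g, 'm) groupoid_scheme \<Rightarrow> ('g \<Rightarrow> 'a \<Rightarrow> 'a) \<Rightarrow> ('g \<Rightarrow> 'g) \<Rightarrow> 'g \<times> 'g \<Rightarrow> 'a \<Rightarrow> 'a" where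
  "beta G \<alpha> \<tau> u a = \<alpha> (\<tau> (snd u)) (\<alpha> (ginv G (\<tau> (fst u))) a)"

definition coarse_skew_ring ::
  "('g, 'm) groupoid_scheme \<Rightarrow> ('a, 'n) ring_scheme \<Rightarrow> ('g \<Rightarrow> 'a set) \<Rightarrow> ('g \<Rightarrow> 'a \<Rightarrow> 'a) \<Rightarrow> ('g \<Rightarrow> 'g)
    \<Rightarrow> ('g \<times> 'g \<Rightarrow> 'a) ring" where
  "coarse_skew_ring G A D \<alpha> \<tau> = skew_groupoid_ring (coarse G) A (beta_dom D) (beta G \<alpha> \<tau>)"

definition gamma_dom ::
  "('g, 'm) groupoid_scheme \<Rightarrow> ('a, 'n) ring_scheme \<Rightarrow> ('g \<Rightarrow> 'a set) \<Rightarrow> ('g \<Rightarrow> 'a \<Rightarrow> 'a) \<Rightarrow> ('g \<Rightarrow> 'g)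
    \<Rightarrow> 'g \<Rightarrow> ('g \<times> 'g \<Rightarrow> 'a) set" where
  "gamma_dom G A D \<alpha> \<tau> h =
     {c \<in> carrier (coarse_skew_ring G A D \<alpha> \<tau>). \<forall>u\<in>mor (coarse G). c u \<in> \<alpha> (\<tau> (snd u)) ` D h}"

text \<open>
  On the coefficient at \<open>u\<close>, which has the form \<open>\<alpha> (\<tau> (snd u)) a\<close>, the element \<open>a\<close> is recovered
  by applying \<open>\<alpha> (ginv G (\<tau> (snd u)))\<close>, the inverse of \<open>\<alpha> (\<tau> (snd u))\<close>.
\<close>

definition gamma ::
  "('g, 'm) groupoid_scheme \<Rightarrow> ('a, 'n) ring_scheme \<Rightarrow> ('g \<Rightarrow> 'a \<Rightarrow> 'a) \<Rightarrow> ('g \<Rightarrow> 'g)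
    \<Rightarrow> 'g \<Rightarrow> ('g \<times> 'g \<Rightarrow> 'a) \<Rightarrow> ('g \<times> 'g \<Rightarrow> 'a)" where
  "gamma G A \<alpha> \<tau> h c = (\<lambda>u. if u \<in> mor (coarse G)
     then \<alpha> (\<tau> (snd u)) (\<alpha> h (\<alpha> (ginv G (\<tau> (snd u))) (c u))) else \<zero>\<^bsub>A\<^esub>)"

end

theory Submission
  imports Defs
begin

text \<open>
  Put \<open>T g a = \<alpha> g (a 1\<^bsub>g\<inverse>\<^esub>)\<close>.  These are ring endomorphisms of the whole of \<open>A\<close> with
  \<open>T g (T h a) = 1\<^bsub>g\<^esub> T (g h) a\<close>, and the product of the skew ring is
  \<open>(a \<delta>\<^bsub>g\<^esub>) (b \<delta>\<^bsub>h\<^esub>) = (a T g b) \<delta>\<^bsub>g h\<^esub>\<close>; this gives associativity.  A morphism \<open>g\<close> is determined by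
  its source \<open>y\<close>, its target \<open>z\<close> and \<open>h = \<tau>\<^bsub>z\<^esub>\<inverse> g \<tau>\<^bsub>y\<^esub>\<close> in the isotropy group, and this decomposition is
  compatible with products.  Since \<open>\<tau>\<^bsub>y\<^esub>\<close> has full domain, the twisted maps of \<open>\<beta>\<close> and \<open>\<gamma>\<close> are the
  restrictions of \<open>T\<close> to \<open>\<tau>\<^bsub>z\<^esub> \<tau>\<^bsub>y\<^esub>\<inverse>\<close> and \<open>\<tau>\<^bsub>z\<^esub> h \<tau>\<^bsub>z\<^esub>\<inverse>\<close>.  Hence
  \<open>a \<delta>\<^bsub>g\<^esub> \<mapsto> (a \<delta>\<^bsub>(y, z)\<^esub>) \<delta>\<^bsub>h\<^esub>\<close> is multiplicative, and the ring structure of the target is transported along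
  this bijection.
\<close>

section \<open>Twisted maps of a unital partial action\<close>

text \<open>Cutting \<open>a\<close> down by the unit of the domain makes the map total on the ring.
  Groupoid, ring and domains are all parameters because the same formula is applied to \<alpha> over
  \<open>A\<close>, to \<beta> over the coarse groupoid and to \<gamma> over the coarse skew
  ring.\<close>

definition twist ::
  "('g, 'm) groupoid_scheme \<Rightarrow> ('a, 'n) ring_scheme \<Rightarrow> ('g \<Rightarrow> 'a set) \<Rightarrow> ('g \<Rightarrow> 'a \<Rightarrow> 'a) \<Rightarrow> 'g \<Rightarrow> 'a \<Rightarrow> 'a"
where
  "twist G A D \<alpha> g a = \<alpha> g (a \<otimes>\<^bsub>A\<^esub> ideal_unit A (D (ginv G g)))"

section \<open>Inverses and cancellation in a groupoid\<close>

context groupoid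
begin

lemma ginv:
  assumes "g \<in> mor G"
  shows ginv_closed: "ginv G g \<in> mor G"
    and src_ginv: "src G (ginv G g) = tgt G g"
    and tgt_ginv: "tgt G (ginv G g) = src G g"
    and cmp_ginv: "g \<cdot> ginv G g = tgt G g"
    and ginv_cmp: "ginv G g \<cdot> g = src G g"
proof -
  obtain h where "h \<in> mor G" "src G h = tgt G g" "tgt G h = src G g" "g \<cdot> h = tgt G g" "h \<cdot> g = src G g"
    using invertible[OF assms] by blast
  moreover from this have "ginv G g = h" using ginv_eqI[OF assms] by blast
  ultimately show "ginv G g \<in> mor G" "src G (ginv G g) = tgt G g" "tgt G (ginv G g) = src G g"
    "g \<cdot> ginv G g = tgt G g" "ginv G g \<cdot> g = src G g" by auto
qed

lemma ginv_ginv: "g \<in> mor G \<Longrightarrow> ginv G (ginv G g) = g"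
  by (rule ginv_eqI) (simp_all add: ginv)

text \<open>Since \<open>src G\<close> is idempotent, its image is its set of fixed points.\<close>

lemma objects_iff: "y \<in> objects G \<longleftrightarrow> y \<in> mor G \<and> src G y = y"
  unfolding objects_def using src_closed src_src by force

lemma objectD:
  assumes "y \<in> objects G"
  shows "y \<in> mor G" "src G y = y" "tgt G y = y"
  using assms tgt_src[of y] by (simp_all add: objects_iff)

lemma src_in_objects: "g \<in> mor G \<Longrightarrow> src G g \<in> objects G"
  and tgt_in_objects: "g \<in> mor G \<Longrightarrow> tgt G g \<in> objects G"
  by (simp_all add: objects_iff src_closed src_src tgt_closed src_tgt)

lemma ginv_object: "y \<in> objects G \<Longrightarrow> ginv G y = y"
  using objectD[of y] cmp_src[of y] by (intro ginv_eqI) simp_all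

lemma ginv_cmp_cancel:
  assumes "g \<in> mor G" "h \<in> mor G" "src G g = tgt G h"
  shows "ginv G g \<cdot> (g \<cdot> h) = h" and "(g \<cdot> h) \<cdot> ginv G h = g"
proof -
  show "ginv G g \<cdot> (g \<cdot> h) = h"
    using assms cmp_assoc[of "ginv G g" g h] by (simp add: ginv tgt_cmp_id)
  show "(g \<cdot> h) \<cdot> ginv G h = g"
    using assms cmp_assoc[of g h "ginv G h"] cmp_src[of g] by (simp add: ginv)
qed

lemma cmp_ginv_cancel:
  assumes "g \<in> mor G" "h \<in> mor G"
  shows "tgt G g = tgt G h \<Longrightarrow> g \<cdot> (ginv G g \<cdot> h) = h"
    and "src G g = src G h \<Longrightarrow> (g \<cdot> ginv G h) \<cdot> h = g"
  using assms ginv_cmp_cancel(1)[of "ginv G g" h] ginv_cmp_cancel(2)[of g "ginv G h"]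
  by (simp_all add: ginv ginv_ginv)

end

context nonunital_ring
begin

lemma r_null [simp]: "a \<in> carrier R \<Longrightarrow> a \<otimes> \<zero> = \<zero>"
proof -
  assume a: "a \<in> carrier R"
  then have "a \<otimes> \<zero> = a \<otimes> \<zero> \<oplus> a \<otimes> \<zero>"
    by (metis r_distr r_zero zero_closed)
  then show ?thesis using a by (simp add: m_closed)
qed

lemma l_null [simp]: "a \<in> carrier R \<Longrightarrow> \<zero> \<otimes> a = \<zero>"
proof -
  assume a: "a \<in> carrier R"
  then have "\<zero> \<otimes> a = \<zero> \<otimes> a \<oplus> \<zero> \<otimes> a"
    by (metis l_distr r_zero zero_closed)
  then show ?thesis using a by (simp add: m_closed)
qed

end

section \<open>Ideals with a central unit and the maps between them\<close>

locale unital_action = unital_partial_action G A D \<alpha>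
  for A :: "('a, 'n) ring_scheme" (structure) and G :: "('g, 'm) groupoid_scheme"
    and D :: "'g \<Rightarrow> 'a set" and \<alpha> :: "'g \<Rightarrow> 'a \<Rightarrow> 'a"
begin

abbreviation gcmp (infixl \<open>\<bullet>\<close> 70) where "g \<bullet> h \<equiv> g \<cdot>\<^bsub>G\<^esub> h"
abbreviation e where "e g \<equiv> ideal_unit A (D g)"
abbreviation T where "T \<equiv> twist G A D \<alpha>"

lemma e_generates: "g \<in> mor G \<Longrightarrow> generated_by_idempotent A (D g) (e g)"
  using unital[of g] ideal_unit_eqI[OF nonunital_ring_axioms] by metis

lemma e_central:
  assumes "g \<in> mor G"
  shows e_closed: "e g \<in> carrier A" and e_idem: "e g \<otimes> e g = e g"
    and e_comm: "a \<in> carrier A \<Longrightarrow> a \<otimes> e g = e g \<otimes> a"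
proof -
  show "e g \<in> carrier A" "e g \<otimes> e g = e g" "a \<in> carrier A \<Longrightarrow> a \<otimes> e g = e g \<otimes> a"
    using e_generates[OF assms] unfolding generated_by_idempotent_def central_idempotent_def by blast+
qed

text \<open>Idempotence of \<open>e g\<close> turns the description of the ideal as an image into a
  fixed-point equation, so that closure properties become computations in the ring.\<close>

lemma D_iff: "g \<in> mor G \<Longrightarrow> a \<in> D g \<longleftrightarrow> a \<in> carrier A \<and> a \<otimes> e g = a"
proof -
  assume g: "g \<in> mor G"
  then have D: "a \<in> D g \<longleftrightarrow> (\<exists>b\<in>carrier A. a = b \<otimes> e g)"
    using e_generates unfolding generated_by_idempotent_def by blast
  show ?thesis
  proof
    assume "a \<in> D g"
    then obtain b where "b \<in> carrier A" "a = b \<otimes> e g" using D by blast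
    then show "a \<in> carrier A \<and> a \<otimes> e g = a"
      using e_closed[OF g] e_idem[OF g] by (simp add: m_assoc m_closed)
  next
    assume "a \<in> carrier A \<and> a \<otimes> e g = a"
    then show "a \<in> D g" using D by metis
  qed
qed

lemma D_carrier: "\<lbrakk>g \<in> mor G; a \<in> D g\<rbrakk> \<Longrightarrow> a \<in> carrier A"
  and D_absorb: "\<lbrakk>g \<in> mor G; a \<in> D g\<rbrakk> \<Longrightarrow> a \<otimes> e g = a"
  and D_absorb_left: "\<lbrakk>g \<in> mor G; a \<in> D g\<rbrakk> \<Longrightarrow> e g \<otimes> a = a"
  using D_iff e_comm by metis+

lemma D_ideal:
  assumes "g \<in> mor G"
  shows D_m_left: "\<lbrakk>a \<in> D g; b \<in> carrier A\<rbrakk> \<Longrightarrow> b \<otimes> a \<in> D g"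
    and D_m_right: "\<lbrakk>a \<in> D g; b \<in> carrier A\<rbrakk> \<Longrightarrow> a \<otimes> b \<in> D g"
    and D_e: "e g \<in> D g"
proof -
  note e = e_closed[OF assms] e_idem[OF assms]
  show l: "b \<otimes> a \<in> D g" if "a \<in> D g" "b \<in> carrier A"
    using that e unfolding D_iff[OF assms] by (simp add: m_closed m_assoc)
  have "(a \<otimes> b) \<otimes> e g = (a \<otimes> e g) \<otimes> b" if "a \<in> carrier A" "b \<in> carrier A"
    using that e(1) m_assoc[of a b "e g"] m_assoc[of a "e g" b] e_comm[OF assms that(2)] by simp
  then show "a \<otimes> b \<in> D g" if "a \<in> D g" "b \<in> carrier A"
    using that unfolding D_iff[OF assms] by (simp add: m_closed)
  show "e g \<in> D g" using e unfolding D_iff[OF assms] by blast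
qed

lemma D_subgroup: "g \<in> mor G \<Longrightarrow> additive_subgroup (D g) A"
proof -
  assume g: "g \<in> mor G"
  have "\<ominus> a \<otimes> e g = \<ominus> a" if "a \<in> D g" for a
  proof -
    have a: "a \<in> carrier A" "a \<otimes> e g = a" using that D_iff[OF g] by auto
    then have "\<ominus> a \<otimes> e g \<oplus> a \<otimes> e g = \<zero>"
      using e_closed[OF g] by (metis a_inv_closed l_distr l_neg l_null)
    then show ?thesis using a e_closed[OF g] by (metis a_inv_closed m_closed minus_equality)
  qed
  then show ?thesis using g
    by unfold_locales (auto simp: D_iff l_distr e_closed a_inv_def[symmetric])
qed

lemma D_tgt: "\<lbrakk>g \<in> mor G; a \<in> D g\<rbrakk> \<Longrightarrow> a \<in> D (tgt G g)"
  using additive_subgroup.a_subset[of "D g" "A\<lparr>carrier := D (tgt G g)\<rparr>"] ideal_tgt[of g]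
  by (auto simp: nonunital_ideal_def)

lemma alpha_bij: "g \<in> mor G \<Longrightarrow> bij_betw (\<alpha> g) (D (ginv G g)) (D g)"
  and alpha_add: "\<lbrakk>g \<in> mor G; a \<in> D (ginv G g); b \<in> D (ginv G g)\<rbrakk> \<Longrightarrow> \<alpha> g (a \<oplus> b) = \<alpha> g a \<oplus> \<alpha> g b"
  and alpha_mult: "\<lbrakk>g \<in> mor G; a \<in> D (ginv G g); b \<in> D (ginv G g)\<rbrakk> \<Longrightarrow> \<alpha> g (a \<otimes> b) = \<alpha> g a \<otimes> \<alpha> g b"
  using act_iso[of g] by (auto simp: nonunital_ring_iso_def iso_def hom_def)

lemma alpha_closed: "\<lbrakk>g \<in> mor G; a \<in> D (ginv G g)\<rbrakk> \<Longrightarrow> \<alpha> g a \<in> D g"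
  using alpha_bij bij_betwE by blast

text \<open>The composite \<open>ginv G g \<bullet> g\<close> is the identity at the source of
  \<open>g\<close>, so the extension axiom \<open>act_cmp\<close> followed by
  \<open>act_object\<close> gives the claim.\<close>

lemma alpha_inverse:
  assumes g: "g \<in> mor G" and a: "a \<in> D (ginv G g)"
  shows "\<alpha> (ginv G g) (\<alpha> g a) = a"
proof -
  have "\<alpha> g a \<in> D (ginv G (ginv G g))" using alpha_closed[OF g a] by (simp add: ginv_ginv g)
  then have "\<alpha> (ginv G g \<bullet> g) a = \<alpha> (ginv G g) (\<alpha> g a)"
    using act_cmp[of "ginv G g" g a] g a by (simp add: ginv)
  moreover have "a \<in> D (src G g)" using D_tgt[of "ginv G g" a] g a by (simp add: ginv)
  ultimately show ?thesis using act_object[OF src_in_objects[OF g]] ginv_cmp[OF g] by metis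
qed

lemma alpha_inverse':
  assumes g: "g \<in> mor G" and a: "a \<in> D g"
  shows "\<alpha> g (\<alpha> (ginv G g) a) = a"
  using alpha_inverse[OF ginv_closed[OF g]] a unfolding ginv_ginv[OF g] by blast

lemma alpha_e:
  assumes g: "g \<in> mor G"
  shows "\<alpha> g (e (ginv G g)) = e g"
proof -
  let ?i = "ginv G g"
  have i: "?i \<in> mor G" using g by (simp add: ginv)
  have "\<alpha> ?i (e g) \<in> D ?i" using alpha_closed[OF i] D_e[OF g] by (simp add: ginv_ginv g)
  then have "\<alpha> g (e ?i \<otimes> \<alpha> ?i (e g)) = \<alpha> g (e ?i) \<otimes> e g"
    using alpha_mult[OF g] D_e[OF i] alpha_inverse'[OF g D_e[OF g]] by simp
  moreover have "e ?i \<otimes> \<alpha> ?i (e g) = \<alpha> ?i (e g)"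
    using D_absorb_left[OF i] \<open>\<alpha> ?i (e g) \<in> D ?i\<close> by blast
  ultimately show ?thesis
    using alpha_inverse'[OF g D_e[OF g]] D_absorb[OF g alpha_closed[OF g D_e[OF i]]] by simp
qed

section \<open>Total twisted maps and their composition law\<close>

lemma T_closed: "\<lbrakk>g \<in> mor G; a \<in> carrier A\<rbrakk> \<Longrightarrow> T g a \<in> D g"
  unfolding twist_def by (rule alpha_closed) (simp_all add: D_ideal ginv)

lemma T_carrier: "\<lbrakk>g \<in> mor G; a \<in> carrier A\<rbrakk> \<Longrightarrow> T g a \<in> carrier A"
  using T_closed D_carrier by blast

lemma T_eq_alpha: "\<lbrakk>g \<in> mor G; a \<in> D (ginv G g)\<rbrakk> \<Longrightarrow> T g a = \<alpha> g a"
  unfolding twist_def by (simp add: D_absorb ginv)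

lemma T_add: "\<lbrakk>g \<in> mor G; a \<in> carrier A; b \<in> carrier A\<rbrakk> \<Longrightarrow> T g (a \<oplus> b) = T g a \<oplus> T g b"
  unfolding twist_def by (simp add: l_distr e_closed ginv alpha_add D_ideal)

text \<open>Centrality and idempotence allow the unit to be copied onto both factors before the
  multiplicative map \<open>\<alpha> g\<close> is applied.\<close>

lemma T_mult:
  assumes "g \<in> mor G" "a \<in> carrier A" "b \<in> carrier A"
  shows "T g (a \<otimes> b) = T g a \<otimes> T g b"
proof -
  have i: "ginv G g \<in> mor G" using assms by (simp add: ginv)
  have "(a \<otimes> b) \<otimes> e (ginv G g) = (a \<otimes> e (ginv G g)) \<otimes> (b \<otimes> e (ginv G g))"
    using assms e_closed[OF i] e_idem[OF i] e_comm[OF i] m_assoc m_closed by metis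
  then show ?thesis unfolding twist_def using assms i by (simp add: alpha_mult D_ideal)
qed

lemma T_absorb:
  assumes "g \<in> mor G" "a \<in> carrier A"
  shows "T g (a \<otimes> e (ginv G g)) = T g a"
  unfolding twist_def using assms by (simp add: m_assoc e_closed e_idem ginv)

lemma T_object: "\<lbrakk>y \<in> objects G; a \<in> carrier A\<rbrakk> \<Longrightarrow> T y a = a \<otimes> e y"
  unfolding twist_def by (simp add: ginv_object act_object objectD D_ideal)

text \<open>The product of the two idempotents is the unit of
  \<open>D h \<inter> D (ginv G g)\<close>, the set where \<open>\<alpha> g\<close> can follow
  \<open>\<alpha> h\<close>. Its preimage under \<open>\<alpha> h\<close> is therefore the unit of
  the domain of the composite.\<close>

definition meet_unit :: "'g \<Rightarrow> 'g \<Rightarrow> 'a" where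
  "meet_unit g h = \<alpha> (ginv G h) (e h \<otimes> e (ginv G g))"

lemma meet_unit:
  assumes g: "g \<in> mor G" and h: "h \<in> mor G" and gh: "src G g = tgt G h"
  shows meet_unit_in: "meet_unit g h \<in> D (ginv G h)" "meet_unit g h \<in> D (ginv G (g \<bullet> h))"
    and alpha_meet_unit: "\<alpha> h (meet_unit g h) = e h \<otimes> e (ginv G g)" "\<alpha> (g \<bullet> h) (meet_unit g h) \<in> D g"
proof -
  have ig: "ginv G g \<in> mor G" and ih: "ginv G h \<in> mor G" using g h by (simp_all add: ginv)
  have p: "e h \<otimes> e (ginv G g) \<in> D h" "e h \<otimes> e (ginv G g) \<in> D (ginv G g)"
    using D_ideal g h ig e_closed by auto
  show 1: "meet_unit g h \<in> D (ginv G h)"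
    unfolding meet_unit_def using alpha_closed[OF ih] p h by (simp add: ginv_ginv)
  show 2: "\<alpha> h (meet_unit g h) = e h \<otimes> e (ginv G g)"
    unfolding meet_unit_def using alpha_inverse'[OF h] p by simp
  have "\<alpha> h (meet_unit g h) \<in> D (ginv G g)" using p 2 by simp
  from act_cmp[OF g h gh 1 this] alpha_closed[OF g this]
  show "meet_unit g h \<in> D (ginv G (g \<bullet> h))" "\<alpha> (g \<bullet> h) (meet_unit g h) \<in> D g" by auto
qed

text \<open>
  Both elements are the unit of \<open>D (ginv G h) \<inter> D (ginv G (g \<bullet> h))\<close>, which \<open>\<alpha> h\<close> maps onto
  \<open>D h \<inter> D (ginv G g)\<close> and \<open>\<alpha> (g \<bullet> h)\<close> onto \<open>D (g \<bullet> h) \<inter> D g\<close>.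
\<close>
lemma meet_unit_sym:
  assumes g: "g \<in> mor G" and h: "h \<in> mor G" and gh: "src G g = tgt G h"
  shows "meet_unit (ginv G g) (g \<bullet> h) = meet_unit g h"
proof -
  let ?z = "meet_unit g h" and ?z' = "meet_unit (ginv G g) (g \<bullet> h)"
  \<comment> \<open>This is stated for arbitrary arguments so that it also applies to the pair
    \<open>ginv G g\<close>, \<open>g \<bullet> h\<close>, for which the two elements exchange
    roles. Elements that absorb each other are equal.\<close>
  have absorb: "y \<otimes> x = x \<and> x \<otimes> y = x"
    if g: "g \<in> mor G" and h: "h \<in> mor G" and gh: "src G g = tgt G h"
      and x: "x = meet_unit g h" and y: "y = meet_unit (ginv G g) (g \<bullet> h)" for g h x y
  proof -
    let ?k = "g \<bullet> h"
    have k: "?k \<in> mor G" and ig: "ginv G g \<in> mor G" and ik: "ginv G ?k \<in> mor G"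
      using g h gh by (simp_all add: cmp_closed ginv)
    have kg: "src G (ginv G g) = tgt G ?k" using g h gh by (simp add: ginv tgt_cmp)
    note X = meet_unit[OF g h gh] and Y = meet_unit[OF ig k kg]
    have w: "\<alpha> ?k (meet_unit g h) \<in> D ?k" using alpha_closed[OF k] X by blast
    have "(e ?k \<otimes> e g) \<otimes> \<alpha> ?k (meet_unit g h) = \<alpha> ?k (meet_unit g h)"
      "\<alpha> ?k (meet_unit g h) \<otimes> (e ?k \<otimes> e g) = \<alpha> ?k (meet_unit g h)"
      using w X g k D_absorb D_absorb_left D_carrier e_closed m_assoc by metis+
    \<comment> \<open>The map \<open>\<alpha> ?k\<close> sends \<open>y\<close> to
      \<open>e ?k \<otimes> e g\<close>, which fixes the image of \<open>x\<close>. Injectivity of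
      \<open>\<alpha> ?k\<close> then brings the equations back.\<close>
    then have "\<alpha> ?k (y \<otimes> x) = \<alpha> ?k x" "\<alpha> ?k (x \<otimes> y) = \<alpha> ?k x"
      using X Y alpha_mult[OF k] g unfolding x y by (simp_all add: ginv_ginv)
    moreover have "y \<otimes> x \<in> D (ginv G ?k)" "x \<otimes> y \<in> D (ginv G ?k)" "x \<in> D (ginv G ?k)"
      using X Y D_ideal ik D_carrier unfolding x y by auto
    ultimately show ?thesis using alpha_bij[OF k] unfolding bij_betw_def inj_on_def by metis
  qed
  have "?z' \<otimes> ?z = ?z \<and> ?z \<otimes> ?z' = ?z" using absorb[OF g h gh] by simp
  moreover have "?z \<otimes> ?z' = ?z' \<and> ?z' \<otimes> ?z = ?z'"
    using absorb[of "ginv G g" "g \<bullet> h"] g h gh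
    by (simp add: ginv ginv_ginv cmp_closed tgt_cmp ginv_cmp_cancel)
  ultimately show ?thesis by simp
qed

text \<open>Multiplication by the meet unit moves \<open>a\<close> into the domain of the composite,
  where \<open>act_cmp\<close> applies. The image of the meet unit under \<open>\<alpha> h\<close>
  accounts for the cut-off at \<open>ginv G g\<close>, and its image under
  \<open>\<alpha> (g \<bullet> h)\<close> leaves the factor \<open>e g\<close>.\<close>

lemma T_T:
  assumes g: "g \<in> mor G" and h: "h \<in> mor G" and gh: "src G g = tgt G h" and a: "a \<in> carrier A"
  shows "T g (T h a) = e g \<otimes> T (g \<bullet> h) a"
proof -
  let ?k = "g \<bullet> h" and ?z = "meet_unit g h"
  have k: "?k \<in> mor G" and ig: "ginv G g \<in> mor G" and ih: "ginv G h \<in> mor G" and ik: "ginv G ?k \<in> mor G"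
    using g h gh by (simp_all add: cmp_closed ginv)
  have kg: "src G (ginv G g) = tgt G ?k" using g h gh by (simp add: ginv tgt_cmp)
  note z = meet_unit[OF g h gh]
  have z': "\<alpha> ?k ?z = e ?k \<otimes> e g"
    using meet_unit(3)[OF ig k kg] meet_unit_sym[OF g h gh] g by (simp add: ginv_ginv)
  have zc: "?z \<in> carrier A" using z D_carrier ih by blast
  \<comment> \<open>As \<open>?z\<close> lies in the ideal, inserting the unit of the ideal before
    it changes nothing. This supplies the cut-offs contained in \<open>T h\<close> and in
    \<open>T ?k\<close>.\<close>
  have az: "(a \<otimes> e l) \<otimes> ?z = a \<otimes> ?z" if "l \<in> mor G" "?z \<in> D l" for l
    using that a zc by (simp add: m_assoc e_closed D_absorb_left)
  have Th: "T h a \<otimes> e (ginv G g) = \<alpha> h (a \<otimes> ?z)"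
  proof -
    have "\<alpha> h (a \<otimes> ?z) = \<alpha> h ((a \<otimes> e (ginv G h)) \<otimes> ?z)" using az ih z by simp
    also have "\<dots> = T h a \<otimes> (e h \<otimes> e (ginv G g))"
      unfolding twist_def using alpha_mult[OF h] z D_ideal a ih by simp
    also have "\<dots> = T h a \<otimes> e (ginv G g)"
      using T_closed[OF h a] D_absorb[OF h] D_carrier[OF h] e_closed h ig m_assoc by metis
    finally show ?thesis ..
  qed
  have 1: "a \<otimes> ?z \<in> D (ginv G h)" using z D_ideal ih a by blast
  have 2: "\<alpha> h (a \<otimes> ?z) \<in> D (ginv G g)"
    unfolding Th[symmetric] using D_ideal[OF ig] T_carrier[OF h a] by blast
  have "T g (T h a) = \<alpha> ?k (a \<otimes> ?z)"
    using act_cmp[OF g h gh 1 2] Th by (simp add: twist_def)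
  also have "\<dots> = \<alpha> ?k ((a \<otimes> e (ginv G ?k)) \<otimes> ?z)" using az ik z by simp
  also have "\<dots> = T ?k a \<otimes> (e ?k \<otimes> e g)"
    unfolding twist_def using alpha_mult[OF k] z z' D_ideal a ik by simp
  also have "\<dots> = T ?k a \<otimes> e g"
    using T_closed[OF k a] D_absorb[OF k] D_carrier[OF k] e_closed k g m_assoc by metis
  also have "\<dots> = e g \<otimes> T ?k a" using e_comm g T_carrier k a by blast
  finally show ?thesis .
qed

section \<open>Composition with morphisms of full domain\<close>

lemma T_T_full:
  assumes "g \<in> mor G" "h \<in> mor G" "src G g = tgt G h" "a \<in> carrier A" "D g = D (tgt G g)"
  shows "T g (T h a) = T (g \<bullet> h) a"
proof -
  have k: "g \<bullet> h \<in> mor G" "tgt G (g \<bullet> h) = tgt G g" using assms by (simp_all add: cmp_closed tgt_cmp)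
  \<comment> \<open>As \<open>D g\<close> is the whole ideal at the target, the factor
    \<open>e g\<close> of \<open>T_T\<close> acts as the identity.\<close>
  have "T (g \<bullet> h) a \<in> D g" using D_tgt[OF k(1) T_closed] k assms by simp
  then show ?thesis using T_T[OF assms(1-4)] D_absorb_left[OF assms(1)] by simp
qed

lemma T_T_inverse:
  assumes g: "g \<in> mor G" and a: "a \<in> D g"
  shows "T g (T (ginv G g) a) = a"
  using alpha_inverse'[OF g a] T_eq_alpha[of "ginv G g" a] T_eq_alpha[OF g]
    alpha_closed[of "ginv G g" a] g a by (simp add: ginv ginv_ginv)

text \<open>Writing \<open>b\<close> as \<open>T h c\<close>, the composition law exhibits
  \<open>T g b\<close> as a multiple of an element of \<open>D (g \<bullet> h)\<close>.\<close>

lemma T_in_D_cmp: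
  assumes g: "g \<in> mor G" and h: "h \<in> mor G" and gh: "src G g = tgt G h" and b: "b \<in> D h"
  shows "T g b \<in> D (g \<bullet> h)"
proof -
  have c: "T (ginv G h) b \<in> carrier A" using T_carrier b h D_carrier by (simp add: ginv)
  have "T g b = e g \<otimes> T (g \<bullet> h) (T (ginv G h) b)"
    using T_T[OF g h gh c] T_T_inverse[OF h b] by simp
  then show ?thesis using D_ideal[of "g \<bullet> h"] T_closed c e_closed g h gh by (simp add: cmp_closed)
qed

text \<open>An element \<open>b\<close> of \<open>D k\<close> is \<open>T k c\<close> with
  \<open>c\<close> in the ideal at the source of \<open>k\<close>, which is \<open>D s\<close>;
  hence \<open>T_in_D_cmp\<close> puts it into \<open>D (k \<bullet> s)\<close>. The converse
  inclusion is the same argument for \<open>k \<bullet> s\<close> and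
  \<open>ginv G s\<close>.\<close>

lemma D_cmp_full:
  assumes k: "k \<in> mor G" and s: "s \<in> mor G" and ks: "src G k = tgt G s"
    and Ds: "D s = D (tgt G s)" "D (ginv G s) = D (src G s)"
  shows "D (k \<bullet> s) = D k"
proof -
  have sub: "D k \<subseteq> D (k \<bullet> s)" if "k \<in> mor G" "s \<in> mor G" "src G k = tgt G s" "D s = D (tgt G s)" for k s
  proof
    fix b assume b: "b \<in> D k"
    have "T (ginv G k) b \<in> D (ginv G k)" using T_closed D_carrier b that by (simp add: ginv)
    then have "T (ginv G k) b \<in> D s" using D_tgt[of "ginv G k"] that by (simp add: ginv)
    then have "T k (T (ginv G k) b) \<in> D (k \<bullet> s)" using T_in_D_cmp that by blast
    then show "b \<in> D (k \<bullet> s)" using T_T_inverse that b by simp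
  qed
  have "D (k \<bullet> s) \<subseteq> D ((k \<bullet> s) \<bullet> ginv G s)"
    using sub[of "k \<bullet> s" "ginv G s"] assms by (simp add: cmp_closed src_cmp ginv)
  then show ?thesis using sub[of k s] assms by (simp add: ginv_cmp_cancel)
qed

text \<open>Full domain of \<open>t\<close> makes \<open>\<alpha> t\<close> agree with
  \<open>T t\<close> on \<open>D h\<close>. Then \<open>T_in_D_cmp\<close> gives one inclusion for
  \<open>t\<close> and the other for \<open>ginv G t\<close>.\<close>

lemma alpha_image_full:
  assumes t: "t \<in> mor G" and h: "h \<in> mor G" and th: "src G t = tgt G h"
    and Dt: "D t = D (tgt G t)" "D (ginv G t) = D (src G t)"
  shows "\<alpha> t ` D h = D (t \<bullet> h)"
proof
  have T: "T t b = \<alpha> t b" if "b \<in> D h" for b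
    using D_tgt[OF h that] T_eq_alpha[OF t] Dt th by simp
  then show "\<alpha> t ` D h \<subseteq> D (t \<bullet> h)" using T_in_D_cmp[OF t h th] by force
  show "D (t \<bullet> h) \<subseteq> \<alpha> t ` D h"
  proof
    fix b assume b: "b \<in> D (t \<bullet> h)"
    have th': "t \<bullet> h \<in> mor G" "tgt G (t \<bullet> h) = tgt G t" using t h th by (simp_all add: cmp_closed tgt_cmp)
    have bt: "b \<in> D t" using D_tgt[OF th'(1) b] Dt th' by simp
    have "T (ginv G t) b \<in> D (ginv G t \<bullet> (t \<bullet> h))"
      using T_in_D_cmp[of "ginv G t" "t \<bullet> h" b] b t th' by (simp add: ginv)
    then have "T (ginv G t) b \<in> D h" using t h th by (simp add: ginv_cmp_cancel)
    then show "b \<in> \<alpha> t ` D h" using T T_T_inverse[OF t bt] by force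
  qed
qed

end

section \<open>The skew groupoid ring is a ring\<close>

text \<open>A product in the iterated skew ring is a sum over isotropy pairs of sums over coarse
  pairs; flattening it makes a single reindexing possible.\<close>

lemma (in abelian_monoid) finsum_Sigma:
  assumes "finite I" "\<And>i. i \<in> I \<Longrightarrow> finite (J i)"
    and "\<And>i j. i \<in> I \<Longrightarrow> j \<in> J i \<Longrightarrow> f i j \<in> carrier G"
  shows "(\<Oplus>i\<in>I. \<Oplus>j\<in>J i. f i j) = (\<Oplus>p\<in>Sigma I J. f (fst p) (snd p))"
  using assms
proof (induction I)
  case empty
  then show ?case by simp
next
  case (insert i I)
  have split: "Sigma (insert i I) J = Pair i ` J i \<union> Sigma I J" by auto
  have "(\<Oplus>p\<in>Pair i ` J i. f (fst p) (snd p)) = (\<Oplus>j\<in>J i. f i j)"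
    using insert.prems by (subst finsum_reindex) (auto simp: inj_on_def)
  moreover have "(\<Oplus>p\<in>Pair i ` J i \<union> Sigma I J. f (fst p) (snd p)) =
      (\<Oplus>p\<in>Pair i ` J i. f (fst p) (snd p)) \<oplus> (\<Oplus>p\<in>Sigma I J. f (fst p) (snd p))"
    using insert by (intro finsum_Un_disjoint) auto
  moreover have "(\<Oplus>i\<in>insert i I. \<Oplus>j\<in>J i. f i j) = (\<Oplus>j\<in>J i. f i j) \<oplus> (\<Oplus>i\<in>I. \<Oplus>j\<in>J i. f i j)"
    using insert by (intro finsum_insert) (auto intro!: finsum_closed)
  ultimately show ?case using insert unfolding split by simp
qed

lemma (in abelian_monoid) finsum_in_subgroup:
  assumes "additive_subgroup H G" "\<And>i. i \<in> I \<Longrightarrow> f i \<in> H"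
  shows "(\<Oplus>i\<in>I. f i) \<in> H"
proof -
  interpret H: additive_subgroup H G by fact
  show ?thesis using assms(2)
  proof (induction I rule: infinite_finite_induct)
    case (insert i I)
    then have "(\<Oplus>i\<in>insert i I. f i) = f i \<oplus> (\<Oplus>i\<in>I. f i)"
      by (intro finsum_insert) (auto intro: H.a_Hcarr)
    then show ?case using insert by simp
  qed (simp_all add: finsum_infinite)
qed

abbreviation supp :: "('a, 'n) ring_scheme \<Rightarrow> ('g \<Rightarrow> 'a) \<Rightarrow> 'g set" where
  "supp A a \<equiv> {g. a g \<noteq> \<zero>\<^bsub>A\<^esub>}"

text \<open>
  The twisted map \<open>twist G A D \<alpha> g\<close> is total on \<open>A\<close>, which makes the product of the skew groupoid
  ring biadditive in its coefficients.
\<close>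
locale skew_system = nonunital_ring A + groupoid G
  for A :: "('a, 'n) ring_scheme" (structure) and G :: "('g, 'm) groupoid_scheme"
    and D :: "'g \<Rightarrow> 'a set" and \<alpha> :: "'g \<Rightarrow> 'a \<Rightarrow> 'a" +
  assumes coeff_subgroup: "g \<in> mor G \<Longrightarrow> additive_subgroup (D g) A"
    and twist_closed: "\<lbrakk>g \<in> mor G; a \<in> carrier A\<rbrakk> \<Longrightarrow> twist G A D \<alpha> g a \<in> carrier A"
    and twist_add: "\<lbrakk>g \<in> mor G; a \<in> carrier A; b \<in> carrier A\<rbrakk>
          \<Longrightarrow> twist G A D \<alpha> g (a \<oplus> b) = twist G A D \<alpha> g a \<oplus> twist G A D \<alpha> g b"
    and coeff_closed: "\<lbrakk>g \<in> mor G; h \<in> mor G; src G g = tgt G h; a \<in> D g; b \<in> D h\<rbrakk>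
          \<Longrightarrow> a \<otimes> twist G A D \<alpha> g b \<in> D (g \<cdot>\<^bsub>G\<^esub> h)"
    and coeff_assoc: "\<lbrakk>g \<in> mor G; h \<in> mor G; k \<in> mor G; src G g = tgt G h; src G h = tgt G k;
          a \<in> D g; b \<in> D h; c \<in> D k\<rbrakk>
          \<Longrightarrow> (a \<otimes> twist G A D \<alpha> g b) \<otimes> twist G A D \<alpha> (g \<cdot>\<^bsub>G\<^esub> h) c
            = a \<otimes> twist G A D \<alpha> g (b \<otimes> twist G A D \<alpha> h c)"
begin

abbreviation T where "T \<equiv> twist G A D \<alpha>"
abbreviation S where "S \<equiv> skew_groupoid_ring G A D \<alpha>"

section \<open>Coefficients, sums and products in a skew system\<close>

lemma coeff_carrier: "\<lbrakk>g \<in> mor G; a \<in> D g\<rbrakk> \<Longrightarrow> a \<in> carrier A"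
  using additive_subgroup.a_Hcarr coeff_subgroup by metis

lemma coeff_zero: "g \<in> mor G \<Longrightarrow> \<zero> \<in> D g"
  and coeff_add: "\<lbrakk>g \<in> mor G; a \<in> D g; b \<in> D g\<rbrakk> \<Longrightarrow> a \<oplus> b \<in> D g"
  and coeff_minus: "\<lbrakk>g \<in> mor G; a \<in> D g\<rbrakk> \<Longrightarrow> \<ominus> a \<in> D g"
  using additive_subgroup.zero_closed additive_subgroup.a_closed additive_subgroup.a_inv_closed
    coeff_subgroup abelian_group_axioms by metis+

lemma twist_zero: "g \<in> mor G \<Longrightarrow> T g \<zero> = \<zero>"
  using twist_add[of g \<zero> \<zero>] twist_closed[of g \<zero>] by simp

lemma S_carrier: "a \<in> carrier S \<longleftrightarrow>
    (\<forall>g\<in>mor G. a g \<in> D g) \<and> (\<forall>g. g \<notin> mor G \<longrightarrow> a g = \<zero>) \<and> finite (supp A a)"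
  by (simp add: skew_groupoid_ring_def)

lemma S_coeff:
  assumes "a \<in> carrier S"
  shows "g \<in> mor G \<Longrightarrow> a g \<in> D g" and "a g \<in> carrier A"
    and "a g \<noteq> \<zero> \<Longrightarrow> g \<in> mor G" and "g \<notin> mor G \<Longrightarrow> a g = \<zero>" and "finite (supp A a)"
  using assms coeff_carrier[of g "a g"] by (cases "g \<in> mor G"; auto simp: S_carrier)+

lemma S_add: "(a \<oplus>\<^bsub>S\<^esub> b) g = a g \<oplus> b g" and S_zero: "\<zero>\<^bsub>S\<^esub> g = \<zero>"
  by (simp_all add: skew_groupoid_ring_def)

lemma S_abelian_group: "abelian_group S"
proof (rule abelian_groupI)
  fix a b assume ab: "a \<in> carrier S" "b \<in> carrier S"
  have "supp A (a \<oplus>\<^bsub>S\<^esub> b) \<subseteq> supp A a \<union> supp A b" by (auto simp: S_add)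
  then have "finite (supp A (a \<oplus>\<^bsub>S\<^esub> b))"
    by (rule finite_subset) (simp add: S_coeff(5) ab)
  then show "a \<oplus>\<^bsub>S\<^esub> b \<in> carrier S" using ab by (simp add: S_carrier S_add coeff_add)
next
  fix a assume a: "a \<in> carrier S"
  have "supp A (\<lambda>g. \<ominus> a g) \<subseteq> supp A a" by auto
  then have "finite (supp A (\<lambda>g. \<ominus> a g))"
    by (rule finite_subset) (rule S_coeff(5)[OF a])
  then have "(\<lambda>g. \<ominus> a g) \<in> carrier S" using a by (simp add: S_carrier coeff_minus)
  moreover have "(\<lambda>g. \<ominus> a g) \<oplus>\<^bsub>S\<^esub> a = \<zero>\<^bsub>S\<^esub>"
    using S_coeff(2)[OF a] by (simp add: fun_eq_iff S_add S_zero l_neg)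
  ultimately show "\<exists>b\<in>carrier S. b \<oplus>\<^bsub>S\<^esub> a = \<zero>\<^bsub>S\<^esub>" by blast
next
  show "\<zero>\<^bsub>S\<^esub> \<in> carrier S" by (simp add: S_carrier S_zero coeff_zero)
qed (simp_all add: fun_eq_iff S_add S_zero a_ac S_coeff(2))

definition pairs :: "'g set \<Rightarrow> 'g set \<Rightarrow> 'g \<Rightarrow> ('g \<times> 'g) set" where
  "pairs X Y k = {(g, h). g \<in> X \<and> h \<in> Y \<and> src G g = tgt G h \<and> g \<cdot>\<^bsub>G\<^esub> h = k}"

lemma finite_pairs: "\<lbrakk>finite X; finite Y\<rbrakk> \<Longrightarrow> finite (pairs X Y k)"
  by (rule finite_subset[of _ "X \<times> Y"]) (auto simp: pairs_def)

lemma S_mult_term: "\<lbrakk>a \<in> carrier S; b \<in> carrier S; g \<in> mor G\<rbrakk> \<Longrightarrow> a g \<otimes> T g (b h) \<in> carrier A"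
  by (simp add: S_coeff(2) m_closed twist_closed)

text \<open>Enlarging the supports adds only zero terms, since \<open>T g\<close> fixes zero. The
  freedom in \<open>X\<close> and \<open>Y\<close> lets several products be computed over a common
  index set.\<close>

lemma S_mult:
  assumes a: "a \<in> carrier S" and b: "b \<in> carrier S"
    and X: "finite X" "X \<subseteq> mor G" "supp A a \<subseteq> X" and Y: "finite Y" "Y \<subseteq> mor G" "supp A b \<subseteq> Y"
  shows "(a \<otimes>\<^bsub>S\<^esub> b) k = (\<Oplus>p\<in>pairs X Y k. a (fst p) \<otimes> T (fst p) (b (snd p)))"
proof -
  have "(a \<otimes>\<^bsub>S\<^esub> b) k = (\<Oplus>p\<in>{(g, h). g \<in> mor G \<and> h \<in> mor G \<and> a g \<noteq> \<zero> \<and> b h \<noteq> \<zero> \<and>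
      src G g = tgt G h \<and> g \<cdot>\<^bsub>G\<^esub> h = k}. a (fst p) \<otimes> T (fst p) (b (snd p)))"
    by (simp add: skew_groupoid_ring_def twist_def) (simp only: split_def)
  also have "\<dots> = (\<Oplus>p\<in>pairs X Y k. a (fst p) \<otimes> T (fst p) (b (snd p)))"
  proof (rule add.finprod_mono_neutral_cong_left)
    show "finite (pairs X Y k)" using X Y finite_pairs by blast
    show "{(g, h). g \<in> mor G \<and> h \<in> mor G \<and> a g \<noteq> \<zero> \<and> b h \<noteq> \<zero> \<and> src G g = tgt G h \<and> g \<cdot>\<^bsub>G\<^esub> h = k}
        \<subseteq> pairs X Y k"
      using X Y by (auto simp: pairs_def)
    show "(\<lambda>p. a (fst p) \<otimes> T (fst p) (b (snd p))) \<in> pairs X Y k \<rightarrow> carrier A"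
      using X by (auto simp: pairs_def intro!: S_mult_term[OF a b])
  next
    fix p assume "p \<in> pairs X Y k - {(g, h). g \<in> mor G \<and> h \<in> mor G \<and> a g \<noteq> \<zero> \<and> b h \<noteq> \<zero> \<and>
        src G g = tgt G h \<and> g \<cdot>\<^bsub>G\<^esub> h = k}"
    then have "fst p \<in> mor G" "a (fst p) = \<zero> \<or> b (snd p) = \<zero>" using X Y by (auto simp: pairs_def)
    then show "a (fst p) \<otimes> T (fst p) (b (snd p)) = \<zero>\<^bsub>A\<^esub>"
      using S_coeff(2)[OF a] S_coeff(2)[OF b] by (auto simp: twist_zero twist_closed)
  qed simp
  finally show ?thesis .
qed

lemma supp_subset: "a \<in> carrier S \<Longrightarrow> supp A a \<subseteq> mor G"
  using S_coeff(3) by blast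

lemma S_mult_closed:
  assumes a: "a \<in> carrier S" and b: "b \<in> carrier S"
  shows "a \<otimes>\<^bsub>S\<^esub> b \<in> carrier S"
proof -
  let ?X = "supp A a" and ?Y = "supp A b"
  note m = S_mult[OF a b S_coeff(5)[OF a] supp_subset[OF a] order_refl
      S_coeff(5)[OF b] supp_subset[OF b] order_refl]
  have "(a \<otimes>\<^bsub>S\<^esub> b) k \<in> D k" if "k \<in> mor G" for k
    unfolding m
  proof (rule finsum_in_subgroup[OF coeff_subgroup[OF that]])
    fix p assume p: "p \<in> pairs ?X ?Y k"
    then have "fst p \<in> mor G" "snd p \<in> mor G"
      using supp_subset[OF a] supp_subset[OF b] by (auto simp: pairs_def)
    then show "a (fst p) \<otimes> T (fst p) (b (snd p)) \<in> D k"
      using p S_coeff(1)[OF a] S_coeff(1)[OF b] by (auto simp: pairs_def intro!: coeff_closed)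
  qed
  \<comment> \<open>A nonzero coefficient at \<open>k\<close> needs a composable pair with product
    \<open>k\<close>, so the support lies in the image of a finite set of pairs.\<close>
  moreover have "supp A (a \<otimes>\<^bsub>S\<^esub> b) \<subseteq> (\<lambda>(g, h). g \<cdot>\<^bsub>G\<^esub> h) ` {(g, h) \<in> ?X \<times> ?Y. src G g = tgt G h}"
  proof
    fix k assume "k \<in> supp A (a \<otimes>\<^bsub>S\<^esub> b)"
    then have "pairs ?X ?Y k \<noteq> {}" unfolding m by auto
    then show "k \<in> (\<lambda>(g, h). g \<cdot>\<^bsub>G\<^esub> h) ` {(g, h) \<in> ?X \<times> ?Y. src G g = tgt G h}"
      by (force simp: pairs_def)
  qed
  moreover have "finite {(g, h) \<in> ?X \<times> ?Y. src G g = tgt G h}"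
    by (rule finite_subset[of _ "?X \<times> ?Y"]) (use S_coeff(5)[OF a] S_coeff(5)[OF b] in auto)
  moreover have "(\<lambda>(g, h). g \<cdot>\<^bsub>G\<^esub> h) ` {(g, h) \<in> ?X \<times> ?Y. src G g = tgt G h} \<subseteq> mor G"
    using supp_subset[OF a] supp_subset[OF b] by (auto intro!: cmp_closed)
  ultimately have "\<forall>k\<in>mor G. (a \<otimes>\<^bsub>S\<^esub> b) k \<in> D k" "supp A (a \<otimes>\<^bsub>S\<^esub> b) \<subseteq> mor G"
    "finite (supp A (a \<otimes>\<^bsub>S\<^esub> b))"
    by (blast, blast, meson finite_surj)
  then show ?thesis unfolding S_carrier by blast
qed

lemma S_l_distr:
  assumes a: "a \<in> carrier S" and b: "b \<in> carrier S" and c: "c \<in> carrier S"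
  shows "(a \<oplus>\<^bsub>S\<^esub> b) \<otimes>\<^bsub>S\<^esub> c = a \<otimes>\<^bsub>S\<^esub> c \<oplus>\<^bsub>S\<^esub> b \<otimes>\<^bsub>S\<^esub> c"
proof
  fix k
  interpret S: abelian_group S by (rule S_abelian_group)
  \<comment> \<open>The union contains the supports of both summands and of their sum, so all three
    products are sums over the same pairs.\<close>
  let ?X = "supp A a \<union> supp A b" and ?Y = "supp A c"
  have X: "finite ?X" "?X \<subseteq> mor G" "supp A (a \<oplus>\<^bsub>S\<^esub> b) \<subseteq> ?X"
    using S_coeff(5)[OF a] S_coeff(5)[OF b] supp_subset[OF a] supp_subset[OF b] by (auto simp: S_add)
  note Y = S_coeff(5)[OF c] supp_subset[OF c] order_refl
  have "((a \<oplus>\<^bsub>S\<^esub> b) \<otimes>\<^bsub>S\<^esub> c) k = (\<Oplus>p\<in>pairs ?X ?Y k. (a (fst p) \<oplus> b (fst p)) \<otimes> T (fst p) (c (snd p)))"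
    unfolding S_mult[OF S.a_closed[OF a b] c X Y] by (simp only: S_add)
  also have "\<dots> = (\<Oplus>p\<in>pairs ?X ?Y k. a (fst p) \<otimes> T (fst p) (c (snd p)) \<oplus> b (fst p) \<otimes> T (fst p) (c (snd p)))"
    using X a b c by (intro finsum_cong')
      (auto simp: pairs_def l_distr S_coeff(2) twist_closed intro!: a_closed S_mult_term)
  also have "\<dots> = (a \<otimes>\<^bsub>S\<^esub> c) k \<oplus> (b \<otimes>\<^bsub>S\<^esub> c) k"
    using X a b c S_mult[OF a c X(1,2) _ Y] S_mult[OF b c X(1,2) _ Y]
    by (subst finsum_addf) (auto simp: pairs_def intro!: S_mult_term)
  finally show "((a \<oplus>\<^bsub>S\<^esub> b) \<otimes>\<^bsub>S\<^esub> c) k = (a \<otimes>\<^bsub>S\<^esub> c \<oplus>\<^bsub>S\<^esub> b \<otimes>\<^bsub>S\<^esub> c) k" by (simp add: S_add)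
qed

lemma S_r_distr:
  assumes a: "a \<in> carrier S" and b: "b \<in> carrier S" and c: "c \<in> carrier S"
  shows "c \<otimes>\<^bsub>S\<^esub> (a \<oplus>\<^bsub>S\<^esub> b) = c \<otimes>\<^bsub>S\<^esub> a \<oplus>\<^bsub>S\<^esub> c \<otimes>\<^bsub>S\<^esub> b"
proof
  fix k
  interpret S: abelian_group S by (rule S_abelian_group)
  let ?X = "supp A a \<union> supp A b" and ?Y = "supp A c"
  have X: "finite ?X" "?X \<subseteq> mor G" "supp A (a \<oplus>\<^bsub>S\<^esub> b) \<subseteq> ?X"
    using S_coeff(5)[OF a] S_coeff(5)[OF b] supp_subset[OF a] supp_subset[OF b] by (auto simp: S_add)
  note Y = S_coeff(5)[OF c] supp_subset[OF c] order_refl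
  have "(c \<otimes>\<^bsub>S\<^esub> (a \<oplus>\<^bsub>S\<^esub> b)) k = (\<Oplus>p\<in>pairs ?Y ?X k. c (fst p) \<otimes> T (fst p) (a (snd p) \<oplus> b (snd p)))"
    unfolding S_mult[OF c S.a_closed[OF a b] Y X] by (simp only: S_add)
  also have "\<dots> = (\<Oplus>p\<in>pairs ?Y ?X k. c (fst p) \<otimes> T (fst p) (a (snd p)) \<oplus> c (fst p) \<otimes> T (fst p) (b (snd p)))"
    using Y a b c by (intro finsum_cong')
      (auto simp: pairs_def r_distr S_coeff(2) twist_add twist_closed intro!: a_closed S_mult_term)
  also have "\<dots> = (c \<otimes>\<^bsub>S\<^esub> a) k \<oplus> (c \<otimes>\<^bsub>S\<^esub> b) k"
    using Y a b c S_mult[OF c a Y X(1,2)] S_mult[OF c b Y X(1,2)]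
    by (subst finsum_addf) (auto simp: pairs_def intro!: S_mult_term)
  finally show "(c \<otimes>\<^bsub>S\<^esub> (a \<oplus>\<^bsub>S\<^esub> b)) k = (c \<otimes>\<^bsub>S\<^esub> a \<oplus>\<^bsub>S\<^esub> c \<otimes>\<^bsub>S\<^esub> b) k" by (simp add: S_add)
qed

section \<open>Monomials \<open>a \<delta>\<^sub>g\<close> and associativity\<close>

definition mono :: "'g \<Rightarrow> 'a \<Rightarrow> 'g \<Rightarrow> 'a" where
  "mono g a = (\<lambda>k. if k = g then a else \<zero>)"

lemma mono_closed: "\<lbrakk>g \<in> mor G; a \<in> D g\<rbrakk> \<Longrightarrow> mono g a \<in> carrier S"
  unfolding S_carrier
proof (intro conjI)
  show "finite (supp A (mono g a))"
    by (rule finite_subset[of _ "{g}"]) (auto simp: mono_def)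
qed (auto simp: mono_def coeff_zero)

text \<open>The induction runs over a finite set containing the support: setting one coefficient to
  zero splits off a monomial and removes a point from that set.\<close>

lemma S_induct [consumes 1, case_names zero add_mono]:
  assumes "a \<in> carrier S" and "P \<zero>\<^bsub>S\<^esub>"
    and step: "\<And>g a b. \<lbrakk>g \<in> mor G; a \<in> D g; b \<in> carrier S; P b\<rbrakk> \<Longrightarrow> P (mono g a \<oplus>\<^bsub>S\<^esub> b)"
  shows "P a"
proof -
  have "\<forall>a\<in>carrier S. supp A a \<subseteq> X \<longrightarrow> P a" if "finite X" for X
    using that
  proof (induction X)
    case empty
    have "a = \<zero>\<^bsub>S\<^esub>" if "supp A a \<subseteq> {}" for a using that by (auto simp: fun_eq_iff S_zero)
    then show ?case using assms(2) by metis
  next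
    case (insert g X)
    show ?case
    proof (intro ballI impI)
      fix a assume a: "a \<in> carrier S" "supp A a \<subseteq> insert g X"
      show "P a"
      proof (cases "g \<in> mor G")
        case True
        let ?b = "a(g := \<zero>)"
        have "supp A ?b \<subseteq> supp A a" by auto
        then have b: "?b \<in> carrier S" "supp A ?b \<subseteq> X"
          using a True finite_subset[OF \<open>supp A ?b \<subseteq> supp A a\<close> S_coeff(5)[OF a(1)]]
          by (auto simp: S_carrier coeff_zero)
        moreover have "a = mono g (a g) \<oplus>\<^bsub>S\<^esub> ?b"
          using S_coeff(2)[OF a(1)] by (simp add: fun_eq_iff S_add mono_def)
        ultimately show ?thesis
          using step[of g "a g" ?b] S_coeff(1)[OF a(1)] True insert.IH by metis
      next
        case False
        then have "supp A a \<subseteq> X" using a S_coeff(3) by blast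
        then show ?thesis using insert.IH a by blast
      qed
    qed
  qed
  then show ?thesis using S_coeff(5)[OF assms(1)] assms(1) by blast
qed

lemma mono_mult:
  assumes g: "g \<in> mor G" "a \<in> D g" and h: "h \<in> mor G" "b \<in> D h"
  shows "mono g a \<otimes>\<^bsub>S\<^esub> mono h b =
    (if src G g = tgt G h then mono (g \<cdot>\<^bsub>G\<^esub> h) (a \<otimes> T g b) else \<zero>\<^bsub>S\<^esub>)"
proof
  fix k
  have m: "(mono g a \<otimes>\<^bsub>S\<^esub> mono h b) k =
      (\<Oplus>p\<in>pairs {g} {h} k. mono g a (fst p) \<otimes> T (fst p) (mono h b (snd p)))"
    using g h by (intro S_mult mono_closed) (auto simp: mono_def)
  have c: "a \<otimes> T g b \<in> carrier A" using g h coeff_carrier by (simp add: m_closed twist_closed)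
  show "(mono g a \<otimes>\<^bsub>S\<^esub> mono h b) k =
    (if src G g = tgt G h then mono (g \<cdot>\<^bsub>G\<^esub> h) (a \<otimes> T g b) else \<zero>\<^bsub>S\<^esub>) k"
  proof (cases "src G g = tgt G h \<and> g \<cdot>\<^bsub>G\<^esub> h = k")
    case True
    then have "pairs {g} {h} k = {(g, h)}" by (auto simp: pairs_def)
    then show ?thesis unfolding m using True c by (simp add: mono_def)
  next
    case False
    then have "pairs {g} {h} k = {}" by (auto simp: pairs_def)
    then show ?thesis unfolding m using False by (auto simp: mono_def S_zero)
  qed
qed

text \<open>Both sides of the associative law are additive in each factor, so
  \<open>S_induct\<close> reduces them to monomials one factor at a time, the last factor first. For
  monomials the law is \<open>coeff_assoc\<close>, and both sides vanish unless both neighbouring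
  pairs compose.\<close>

lemma nonunital_ring_S: "nonunital_ring S"
proof -
  interpret S: abelian_group S by (rule S_abelian_group)
  have z: "\<zero>\<^bsub>S\<^esub> \<otimes>\<^bsub>S\<^esub> a = \<zero>\<^bsub>S\<^esub>" "a \<otimes>\<^bsub>S\<^esub> \<zero>\<^bsub>S\<^esub> = \<zero>\<^bsub>S\<^esub>" for a
    by (simp_all add: skew_groupoid_ring_def)
  have mono3: "(mono g a \<otimes>\<^bsub>S\<^esub> mono h b) \<otimes>\<^bsub>S\<^esub> mono k c = mono g a \<otimes>\<^bsub>S\<^esub> (mono h b \<otimes>\<^bsub>S\<^esub> mono k c)"
    if "g \<in> mor G" "a \<in> D g" "h \<in> mor G" "b \<in> D h" "k \<in> mor G" "c \<in> D k" for g a h b k c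
    using that by (auto simp: mono_mult z cmp_closed coeff_closed src_cmp tgt_cmp cmp_assoc coeff_assoc)
  note simps = z S_l_distr S_r_distr S_mult_closed mono_closed mono3
  have mono2: "(mono g a \<otimes>\<^bsub>S\<^esub> mono h b) \<otimes>\<^bsub>S\<^esub> c = mono g a \<otimes>\<^bsub>S\<^esub> (mono h b \<otimes>\<^bsub>S\<^esub> c)"
    if "c \<in> carrier S" "g \<in> mor G" "a \<in> D g" "h \<in> mor G" "b \<in> D h" for g a h b c
    using that by (induction c rule: S_induct) (simp_all add: simps)
  have mono1: "(mono g a \<otimes>\<^bsub>S\<^esub> b) \<otimes>\<^bsub>S\<^esub> c = mono g a \<otimes>\<^bsub>S\<^esub> (b \<otimes>\<^bsub>S\<^esub> c)"
    if "b \<in> carrier S" "c \<in> carrier S" "g \<in> mor G" "a \<in> D g" for g a b c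
    using that by (induction b rule: S_induct) (simp_all add: simps mono2)
  have "(a \<otimes>\<^bsub>S\<^esub> b) \<otimes>\<^bsub>S\<^esub> c = a \<otimes>\<^bsub>S\<^esub> (b \<otimes>\<^bsub>S\<^esub> c)"
    if "a \<in> carrier S" "b \<in> carrier S" "c \<in> carrier S" for a b c
    using that by (induction a rule: S_induct) (simp_all add: simps mono1)
  then show ?thesis by unfold_locales (simp_all add: simps)
qed

text \<open>Addition is coordinatewise. Applied to the coarse skew ring, this reads off single
  coefficients from the sums that define products in the iterated ring.\<close>

lemma finsum_S_apply:
  assumes "\<And>i. i \<in> I \<Longrightarrow> f i \<in> carrier S"
  shows "(\<Oplus>\<^bsub>S\<^esub>i\<in>I. f i) k = (\<Oplus>i\<in>I. f i k)"
proof -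
  interpret S: nonunital_ring S by (rule nonunital_ring_S)
  show ?thesis using assms
  proof (induction I rule: infinite_finite_induct)
    case (insert i I)
    then have "(\<Oplus>\<^bsub>S\<^esub>i\<in>insert i I. f i) = f i \<oplus>\<^bsub>S\<^esub> (\<Oplus>\<^bsub>S\<^esub>i\<in>I. f i)"
      by (intro S.finsum_insert) auto
    moreover have "(\<Oplus>i\<in>insert i I. f i k) = f i k \<oplus> (\<Oplus>i\<in>I. f i k)"
      using insert S_coeff(2) by (intro finsum_insert) auto
    ultimately show ?case using insert by (simp add: S_add)
  qed (simp_all add: finsum_infinite S.finsum_infinite S_zero)
qed

end

sublocale unital_action \<subseteq> skew: skew_system A G D \<alpha>
proof (intro skew_system.intro skew_system_axioms.intro nonunital_ring_axioms groupoid_axioms)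
  fix g h k a b c
  assume ghk: "g \<in> mor G" "h \<in> mor G" "k \<in> mor G" "src G g = tgt G h" "src G h = tgt G k"
    and "a \<in> D g" "b \<in> D h" "c \<in> D k"
  then have abc: "a \<in> carrier A" "b \<in> carrier A" "c \<in> carrier A" using D_carrier by auto
  have Tc: "T g b \<in> carrier A" "T h c \<in> carrier A" "T (g \<bullet> h) c \<in> carrier A"
    using ghk abc by (simp_all add: T_carrier cmp_closed)
  \<comment> \<open>Associativity rests on \<open>T_T\<close>: its extra factor \<open>e g\<close>
    is absorbed by \<open>T g b\<close>, which lies in \<open>D g\<close>.\<close>
  have "T g (b \<otimes> T h c) = T g b \<otimes> (e g \<otimes> T (g \<bullet> h) c)"
    using T_mult[OF ghk(1) abc(2) Tc(2)] T_T[OF ghk(1,2,4) abc(3)] by simp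
  also have "\<dots> = T g b \<otimes> T (g \<bullet> h) c"
    using D_absorb[OF ghk(1) T_closed[OF ghk(1) abc(2)]] Tc e_closed[OF ghk(1)] by (metis m_assoc)
  finally show "(a \<otimes> T g b) \<otimes> T (g \<bullet> h) c = a \<otimes> T g (b \<otimes> T h c)"
    using abc Tc by (simp add: m_assoc)
qed (simp_all add: D_subgroup T_carrier T_add T_in_D_cmp D_m_left D_carrier cmp_closed)

section \<open>The action of the isotropy group on the coarse skew ring\<close>

lemma (in abelian_monoid) finsum_single:
  assumes "finite I" "i \<in> I" "f i \<in> carrier G" "\<And>j. \<lbrakk>j \<in> I; j \<noteq> i\<rbrakk> \<Longrightarrow> f j = \<zero>"
  shows "(\<Oplus>j\<in>I. f j) = f i"
proof -
  have "f \<in> I \<rightarrow> carrier G"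
  proof
    fix j assume "j \<in> I"
    then show "f j \<in> carrier G" using assms by (cases "j = i") simp_all
  qed
  then have "(\<Oplus>j\<in>{i}. f j) = (\<Oplus>j\<in>I. f j)"
    using assms by (intro add.finprod_mono_neutral_cong_left) auto
  then show ?thesis using assms by simp
qed

locale group_type_action = unital_action A G D \<alpha>
  for A :: "('a, 'n) ring_scheme" (structure) and G :: "('g, 'm) groupoid_scheme"
    and D :: "'g \<Rightarrow> 'a set" and \<alpha> :: "'g \<Rightarrow> 'a \<Rightarrow> 'a" +
  fixes x :: 'g and \<tau> :: "'g \<Rightarrow> 'g"
  assumes finite_objects: "finite (objects G)" and x: "x \<in> objects G"
    and full: "full_transversal G D x \<tau>"
begin

abbreviation H where "H \<equiv> isotropy G x"
abbreviation C where "C \<equiv> coarse_skew_ring G A D \<alpha> \<tau>"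
abbreviation Cdom where "Cdom \<equiv> gamma_dom G A D \<alpha> \<tau>"
abbreviation \<gamma> where "\<gamma> \<equiv> gamma G A \<alpha> \<tau>"

section \<open>The transversal and the decomposition of morphisms\<close>

lemma tau:
  assumes "y \<in> objects G"
  shows "\<tau> y \<in> mor G" "src G (\<tau> y) = x" "tgt G (\<tau> y) = y"
    "D (ginv G (\<tau> y)) = D x" "D (\<tau> y) = D y"
  using full assms unfolding full_transversal_def transversal_def by auto

lemma mor_H: "h \<in> mor H \<longleftrightarrow> h \<in> mor G \<and> src G h = x \<and> tgt G h = x"
  by (simp add: isotropy_def)

lemma mor_coarse: "u \<in> mor (coarse G) \<longleftrightarrow> fst u \<in> objects G \<and> snd u \<in> objects G"
  by (cases u) (simp add: coarse_def)

lemma finite_coarse: "finite (mor (coarse G))"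
  using finite_objects by (simp add: coarse_def)

lemma H_simps: "src H = src G" "tgt H = tgt G" "g \<cdot>\<^bsub>H\<^esub> h = g \<bullet> h"
  by (simp_all add: isotropy_def)

lemma x_in_H: "x \<in> mor H"
  using objectD[OF x] by (simp add: mor_H)

lemma H_cmp: "\<lbrakk>g \<in> mor H; h \<in> mor H\<rbrakk> \<Longrightarrow> g \<bullet> h \<in> mor H"
  by (simp add: mor_H cmp_closed src_cmp tgt_cmp)

lemma H_ginv: "h \<in> mor H \<Longrightarrow> ginv G h \<in> mor H"
  by (simp add: mor_H ginv)

lemma ginv_H: "h \<in> mor H \<Longrightarrow> ginv H h = ginv G h"
proof -
  assume h: "h \<in> mor H"
  interpret H: groupoid H using groupoid_isotropy[OF groupoid_axioms x] .
  show ?thesis using h H_ginv[OF h]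
    by (intro H.ginv_eqI) (simp_all add: isotropy_def ginv)
qed

lemma ginv_coarse:
  assumes "u \<in> mor (coarse G)"
  shows "ginv (coarse G) u = (snd u, fst u)"
proof -
  interpret K: groupoid "coarse G" by (rule groupoid_coarse)
  show ?thesis using assms by (intro K.ginv_eqI) (simp_all add: coarse_def mem_Times_iff)
qed

text \<open>
  Every morphism of \<open>G\<close> is \<open>spread h u\<close> for exactly one \<open>h\<close> in the isotropy group and one coarse
  morphism \<open>u\<close>.
\<close>
definition spread :: "'g \<Rightarrow> 'g \<times> 'g \<Rightarrow> 'g" where
  "spread h u = (\<tau> (snd u) \<bullet> h) \<bullet> ginv G (\<tau> (fst u))"

lemma spread:
  assumes h: "h \<in> mor H" and u: "u \<in> mor (coarse G)"
  shows spread_closed: "spread h u \<in> mor G" and src_spread: "src G (spread h u) = fst u"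
    and tgt_spread: "tgt G (spread h u) = snd u"
  using assms unfolding spread_def mor_H mor_coarse
  by (simp_all add: cmp_closed src_cmp tgt_cmp ginv tau)

text \<open>The condition \<open>fst u = snd v\<close> places the inverse of a transversal element
  next to that element in the middle of the product, where the two cancel.\<close>

lemma spread_cmp:
  assumes g: "g \<in> mor H" and h: "h \<in> mor H" and u: "u \<in> mor (coarse G)" and v: "v \<in> mor (coarse G)"
    and uv: "fst u = snd v"
  shows "spread g u \<bullet> spread h v = spread (g \<bullet> h) (fst v, snd u)"
proof -
  note [simp] = cmp_closed src_cmp tgt_cmp ginv
  define r s t where "r = \<tau> (fst v)" and "s = \<tau> (snd v)" and "t = \<tau> (snd u)"
  have rst: "r \<in> mor G" "src G r = x" "s \<in> mor G" "src G s = x" "t \<in> mor G" "src G t = x"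
    using u v tau by (simp_all add: r_def s_def t_def mor_coarse)
  have gh: "g \<in> mor G" "src G g = x" "tgt G g = x" "h \<in> mor G" "src G h = x" "tgt G h = x"
    using g h by (simp_all add: mor_H)
  have "((t \<bullet> g) \<bullet> ginv G s) \<bullet> ((s \<bullet> h) \<bullet> ginv G r) = (t \<bullet> g) \<bullet> (ginv G s \<bullet> (s \<bullet> (h \<bullet> ginv G r)))"
    using rst gh by (simp add: cmp_assoc)
  also have "ginv G s \<bullet> (s \<bullet> (h \<bullet> ginv G r)) = h \<bullet> ginv G r"
    using rst gh by (intro ginv_cmp_cancel) simp_all
  also have "(t \<bullet> g) \<bullet> (h \<bullet> ginv G r) = (t \<bullet> (g \<bullet> h)) \<bullet> ginv G r"
    using rst gh by (simp add: cmp_assoc)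
  finally show ?thesis unfolding spread_def r_def s_def t_def uv by simp
qed

lemma spread_object: "y \<in> objects G \<Longrightarrow> spread x (y, y) = y"
  using cmp_src[of "\<tau> y"] tau[of y] by (simp add: spread_def ginv)

lemma ginv_spread:
  assumes h: "h \<in> mor H" and u: "u \<in> mor (coarse G)"
  shows "ginv G (spread h u) = spread (ginv G h) (snd u, fst u)"
proof -
  have i: "ginv G h \<in> mor H" "(snd u, fst u) \<in> mor (coarse G)"
    using assms H_ginv by (simp_all add: mor_coarse)
  have "h \<bullet> ginv G h = x" "ginv G h \<bullet> h = x" using h by (simp_all add: mor_H ginv)
  then show ?thesis using assms i
    by (intro ginv_eqI) (simp_all add: spread spread_cmp spread_object mor_coarse)
qed

text \<open>The transversal carries \<open>k\<close> back to a loop at \<open>x\<close>. Together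
  with the pair of ends of \<open>k\<close> this inverts \<open>spread\<close>.\<close>

definition core :: "'g \<Rightarrow> 'g" where
  "core k = (ginv G (\<tau> (tgt G k)) \<bullet> k) \<bullet> \<tau> (src G k)"

lemma core_closed: "k \<in> mor G \<Longrightarrow> core k \<in> mor H"
  unfolding core_def mor_H
  by (simp add: cmp_closed src_cmp tgt_cmp ginv tau src_in_objects tgt_in_objects)

lemma ends_closed: "k \<in> mor G \<Longrightarrow> (src G k, tgt G k) \<in> mor (coarse G)"
  by (simp add: mor_coarse src_in_objects tgt_in_objects)

lemma spread_core: "k \<in> mor G \<Longrightarrow> spread (core k) (src G k, tgt G k) = k"
  \<comment> \<open>Brackets are moved to the left, which brings each transversal element next to
    its inverse.\<close>
  unfolding spread_def core_def
  using tau[OF src_in_objects] tau[OF tgt_in_objects]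
  by (simp add: cmp_closed src_cmp tgt_cmp ginv cmp_assoc[symmetric] cmp_ginv_cancel
      ginv_cmp_cancel tgt_cmp_id)

lemma core_spread:
  assumes h: "h \<in> mor H" and u: "u \<in> mor (coarse G)"
  shows "core (spread h u) = h"
  unfolding core_def src_spread[OF h u] tgt_spread[OF h u] unfolding spread_def
  using h u tau[of "fst u"] tau[of "snd u"] tgt_cmp_id[of h] unfolding mor_H mor_coarse
  by (simp add: cmp_closed src_cmp tgt_cmp ginv cmp_assoc[symmetric] cmp_ginv_cancel
      ginv_cmp_cancel tgt_cmp_id)

lemma spread_inj:
  assumes "g \<in> mor H" "u \<in> mor (coarse G)" "h \<in> mor H" "v \<in> mor (coarse G)" "spread g u = spread h v"
  shows "g = h" "u = v"
  using assms core_spread spread(2,3) by (metis, metis prod.expand)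

text \<open>The right factor of \<open>spread h u\<close> has full domain and drops out by
  \<open>D_cmp_full\<close>; the left one is handled by \<open>alpha_image_full\<close>. The second
  form identifies the coefficient ideals of \<open>gamma_dom\<close> with domains of
  \<alpha>.\<close>

lemma D_spread:
  assumes h: "h \<in> mor H" and u: "u \<in> mor (coarse G)"
  shows "D (spread h u) = D (\<tau> (snd u) \<bullet> h)" and "D (spread h u) = \<alpha> (\<tau> (snd u)) ` D h"
proof -
  have "D (spread h u) = D (\<tau> (snd u) \<bullet> h)" unfolding spread_def
    using h u tau[of "fst u"] tau[of "snd u"] unfolding mor_H mor_coarse
    by (intro D_cmp_full) (simp_all add: cmp_closed src_cmp tgt_cmp ginv ginv_ginv)
  moreover have "\<alpha> (\<tau> (snd u)) ` D h = D (\<tau> (snd u) \<bullet> h)"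
    using h u tau[of "snd u"] unfolding mor_H mor_coarse by (intro alpha_image_full) simp_all
  ultimately show "D (spread h u) = D (\<tau> (snd u) \<bullet> h)" "D (spread h u) = \<alpha> (\<tau> (snd u)) ` D h" by auto
qed

lemma D_spread_snd:
  assumes "h \<in> mor H" "u \<in> mor (coarse G)" "v \<in> mor (coarse G)" "snd u = snd v"
  shows "D (spread h u) = D (spread h v)"
  using D_spread(1) assms by metis

lemma D_spread_x: "u \<in> mor (coarse G) \<Longrightarrow> D (spread x u) = D (snd u)"
  using D_spread(1)[OF x_in_H] cmp_src[of "\<tau> (snd u)"] tau[of "snd u"] by (simp add: mor_coarse)

lemma D_spread_snd_object: "\<lbrakk>h \<in> mor H; u \<in> mor (coarse G); a \<in> D (spread h u)\<rbrakk> \<Longrightarrow> a \<in> D (snd u)"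
  using D_tgt[of "spread h u" a] by (simp add: spread)

text \<open>By \<open>D_spread_x\<close> the morphism \<open>spread x u\<close> has full domain, so
  the composition law carries no correcting unit.\<close>

lemma T_spread_x:
  assumes "g \<in> mor H" "u \<in> mor (coarse G)" "v \<in> mor (coarse G)" "fst u = snd v" "a \<in> carrier A"
  shows "T (spread x u) (T (spread g v) a) = T (spread g (fst v, snd u)) a"
proof -
  have "x \<bullet> g = g" using assms tgt_cmp_id[of g] by (simp add: mor_H)
  then show ?thesis
    using T_T_full[of "spread x u" "spread g v" a] assms x_in_H by (simp add: spread spread_cmp D_spread_x)
qed

text \<open>Each unit \<open>e k\<close> equals \<open>T k (e (ginv G k))\<close>. The morphisms
  \<open>spread h v\<close> and \<open>spread h (fst v, snd u)\<close> have inverses with the same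
  isotropy part and the same target, hence with the same domain, so both units come from one element
  and \<open>T_spread_x\<close> applies.\<close>

lemma T_spread_e:
  assumes h: "h \<in> mor H" and u: "u \<in> mor (coarse G)" and v: "v \<in> mor (coarse G)" and uv: "fst u = snd v"
  shows "T (spread x u) (e (spread h v)) = e (spread h (fst v, snd u))"
proof -
  have w: "(fst v, snd u) \<in> mor (coarse G)" using u v by (simp add: mor_coarse)
  have Te: "T g (e (ginv G g)) = e g" if "g \<in> mor G" for g
    using that T_eq_alpha D_e alpha_e by (simp add: ginv)
  have "e (ginv G (spread h v)) = e (ginv G (spread h (fst v, snd u)))"
    using D_spread_snd[OF H_ginv[OF h], of "(snd v, fst v)" "(snd u, fst v)"] u v h w
    by (simp add: ginv_spread mor_coarse)
  then have "T (spread x u) (e (spread h v)) = T (spread x u) (T (spread h v) (e (ginv G (spread h (fst v, snd u)))))"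
    using Te[of "spread h v"] spread[OF h v] by simp
  also have "\<dots> = T (spread h (fst v, snd u)) (e (ginv G (spread h (fst v, snd u))))"
    using assms w by (intro T_spread_x) (simp_all add: e_closed spread ginv)
  also have "\<dots> = e (spread h (fst v, snd u))" using Te spread h w by simp
  finally show ?thesis .
qed

lemma twist_coarse:
  assumes u: "u \<in> mor (coarse G)" and a: "a \<in> carrier A"
  shows "twist (coarse G) A (beta_dom D) (beta G \<alpha> \<tau>) u a = T (spread x u) a"
proof -
  let ?s = "\<tau> (fst u)" and ?t = "\<tau> (snd u)"
  note s = tau[of "fst u"] and t = tau[of "snd u"]
  have st: "fst u \<in> objects G" "snd u \<in> objects G" using u by (simp_all add: mor_coarse)
  have "twist (coarse G) A (beta_dom D) (beta G \<alpha> \<tau>) u a = \<alpha> ?t (\<alpha> (ginv G ?s) (a \<otimes> e (fst u)))"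
    using u by (simp add: twist_def beta_def beta_dom_def ginv_coarse)
  \<comment> \<open>The cut-off for \<beta> uses the ideal at \<open>fst u\<close>, which is also
    \<open>D ?s\<close>, the domain of \<open>\<alpha> (ginv G ?s)\<close>.\<close>
  also have "\<alpha> (ginv G ?s) (a \<otimes> e (fst u)) = T (ginv G ?s) a"
    using s st by (simp add: twist_def ginv_ginv)
  also have "\<alpha> ?t (T (ginv G ?s) a) = T ?t (T (ginv G ?s) a)"
    using s t st a T_closed[of "ginv G ?s" a] by (intro T_eq_alpha[symmetric]) (simp_all add: ginv)
  also have "\<dots> = T (?t \<bullet> ginv G ?s) a"
    using s t st a by (intro T_T_full) (simp_all add: ginv)
  also have "?t \<bullet> ginv G ?s = spread x u"
    using cmp_src[of ?t] t st by (simp add: spread_def)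
  finally show ?thesis .
qed

text \<open>By \<open>spread_cmp\<close> and \<open>spread_object\<close>, \<open>spread x\<close>
  is a functor from the coarse groupoid to \<open>G\<close>, and by \<open>twist_coarse\<close> the
  twisted maps of \<beta> are those of \<alpha> along it. Associativity is therefore
  inherited.\<close>

sublocale coarse: skew_system A "coarse G" "beta_dom D" "beta G \<alpha> \<tau>"
proof (intro skew_system.intro skew_system_axioms.intro groupoid_coarse nonunital_ring_axioms)
  fix u v w a b c
  assume uvw: "u \<in> mor (coarse G)" "v \<in> mor (coarse G)" "w \<in> mor (coarse G)"
    and uv: "src (coarse G) u = tgt (coarse G) v" and vw: "src (coarse G) v = tgt (coarse G) w"
    and "a \<in> beta_dom D u" "b \<in> beta_dom D v" "c \<in> beta_dom D w"
  then have abc: "a \<in> D (spread x u)" "b \<in> D (spread x v)" "c \<in> D (spread x w)"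
    by (simp_all add: beta_dom_def D_spread_x)
  have fs: "fst u = snd v" "fst v = snd w" using uv vw by (simp_all add: coarse_def)
  have uv_cmp: "u \<cdot>\<^bsub>coarse G\<^esub> v = (fst v, snd u)" "(fst v, snd u) \<in> mor (coarse G)"
    using uvw by (simp_all add: coarse_def mem_Times_iff)
  have abcA: "a \<in> carrier A" "b \<in> carrier A" "c \<in> carrier A"
    using abc D_carrier spread_closed[OF x_in_H] uvw by metis+
  have "spread x (fst v, snd u) = spread x u \<bullet> spread x v"
    using spread_cmp[OF x_in_H x_in_H uvw(1,2) fs(1)] objectD[OF x] tgt_cmp_id[of x] by simp
  moreover have "(a \<otimes> T (spread x u) b) \<otimes> T (spread x u \<bullet> spread x v) c = a \<otimes> T (spread x u) (b \<otimes> T (spread x v) c)"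
    using abc uvw fs by (intro skew.coeff_assoc) (simp_all add: spread x_in_H)
  ultimately show "(a \<otimes> twist (coarse G) A (beta_dom D) (beta G \<alpha> \<tau>) u b) \<otimes>
      twist (coarse G) A (beta_dom D) (beta G \<alpha> \<tau>) (u \<cdot>\<^bsub>coarse G\<^esub> v) c =
      a \<otimes> twist (coarse G) A (beta_dom D) (beta G \<alpha> \<tau>) u
        (b \<otimes> twist (coarse G) A (beta_dom D) (beta G \<alpha> \<tau>) v c)"
    using uvw uv_cmp abcA by (simp add: twist_coarse m_closed T_carrier spread x_in_H)
next
  fix u v a b
  assume uv: "u \<in> mor (coarse G)" "v \<in> mor (coarse G)" "src (coarse G) u = tgt (coarse G) v"
    and ab: "a \<in> beta_dom D u" "b \<in> beta_dom D v"
  have b: "b \<in> carrier A" using ab uv D_carrier[of "snd v" b] by (simp add: beta_dom_def mor_coarse objectD)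
  have "a \<otimes> T (spread x u) b \<in> D (snd u)"
    using ab uv b D_m_right[of "snd u" a] T_carrier[of "spread x u" b]
    by (simp add: beta_dom_def mor_coarse objectD spread x_in_H)
  then show "a \<otimes> twist (coarse G) A (beta_dom D) (beta G \<alpha> \<tau>) u b \<in> beta_dom D (u \<cdot>\<^bsub>coarse G\<^esub> v)"
    using uv b by (simp add: twist_coarse beta_dom_def) (simp add: coarse_def)
qed (simp_all add: twist_coarse T_carrier T_add spread x_in_H beta_dom_def D_subgroup mor_coarse objectD)

lemma coarse_pairs: "p \<in> coarse.pairs X Y w \<longleftrightarrow>
    fst p \<in> X \<and> snd p \<in> Y \<and> fst (fst p) = snd (snd p) \<and> w = (fst (snd p), snd (fst p))"
  by (auto simp: coarse.pairs_def) (auto simp: coarse_def)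

section \<open>The coarse skew ring and the units of the domains of \<gamma>\<close>

lemma C_eq: "coarse.S = C"
  by (simp add: coarse_skew_ring_def)

lemmas C_carrier = coarse.S_carrier[unfolded C_eq]
lemmas C_coeff = coarse.S_coeff[unfolded C_eq]
lemmas C_mult_closed = coarse.S_mult_closed[unfolded C_eq]
lemmas C_mult = coarse.S_mult[unfolded C_eq]

lemma C_carrier_iff: "c \<in> carrier C \<longleftrightarrow>
    (\<forall>u\<in>mor (coarse G). c u \<in> D (snd u)) \<and> (\<forall>u. u \<notin> mor (coarse G) \<longrightarrow> c u = \<zero>)"
proof -
  have "finite (supp A c)" if "\<forall>u. u \<notin> mor (coarse G) \<longrightarrow> c u = \<zero>"
    by (rule finite_subset[OF _ finite_coarse]) (use that in auto)
  then show ?thesis unfolding C_carrier beta_dom_def by blast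
qed

lemma C_zero: "\<zero>\<^bsub>C\<^esub> = (\<lambda>u. \<zero>)"
  by (simp add: coarse_skew_ring_def skew_groupoid_ring_def)

lemma Cdom_iff: "h \<in> mor H \<Longrightarrow>
    c \<in> Cdom h \<longleftrightarrow> c \<in> carrier C \<and> (\<forall>u\<in>mor (coarse G). c u \<in> D (spread h u))"
  unfolding gamma_dom_def using D_spread(2) by auto

text \<open>The coarse skew ring behaves like a matrix ring indexed by the objects, so the unit is
  diagonal; its entry at \<open>y\<close> is the unit of the image of \<open>D h\<close> under
  \<open>\<alpha> (\<tau> y)\<close>.\<close>

definition Cunit :: "'g \<Rightarrow> 'g \<times> 'g \<Rightarrow> 'a" where
  "Cunit h = (\<lambda>u. if u \<in> mor (coarse G) \<and> fst u = snd u then e (spread h u) else \<zero>)"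

lemma D_zero: "g \<in> mor G \<Longrightarrow> \<zero> \<in> D g"
  by (rule skew.coeff_zero)

lemma Cunit_closed: "h \<in> mor H \<Longrightarrow> Cunit h \<in> Cdom h"
  by (auto simp: Cdom_iff C_carrier_iff Cunit_def D_zero D_e spread mor_coarse objectD
      intro: D_spread_snd_object[where h = h])

text \<open>\<open>Cunit h\<close> lives on identities, so a single pair survives: \<open>w\<close>
  with the identity at its source, respectively at its target. In the first case
  \<open>T_spread_e\<close> transports the unit along \<open>w\<close>; in the second the identity
  acts trivially on \<open>c w\<close>.\<close>

lemma Cunit_mult:
  assumes h: "h \<in> mor H" and c: "c \<in> carrier C" and w: "w \<in> mor (coarse G)"
  shows "(c \<otimes>\<^bsub>C\<^esub> Cunit h) w = c w \<otimes> e (spread h w)" and "(Cunit h \<otimes>\<^bsub>C\<^esub> c) w = c w \<otimes> e (spread h w)"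
proof -
  let ?K = "mor (coarse G)"
  have E: "Cunit h \<in> carrier C" using Cunit_closed[OF h] Cdom_iff[OF h] by blast
  have K: "finite ?K" "?K \<subseteq> ?K" "supp A d \<subseteq> ?K" if "d \<in> carrier C" for d
    using finite_coarse that by (auto simp: C_carrier_iff)
  have fin: "finite (coarse.pairs ?K ?K w)" by (intro coarse.finite_pairs finite_coarse)
  note pairs = coarse_pairs
  have cA: "c u \<in> carrier A" for u using C_coeff(2)[OF c] .
  have EA: "Cunit h u \<in> carrier A" for u using C_coeff(2)[OF E] .
  have wo: "fst w \<in> objects G" "snd w \<in> objects G" using w by (simp_all add: mor_coarse)
  have "(c \<otimes>\<^bsub>C\<^esub> Cunit h) w =
      (\<Oplus>p\<in>coarse.pairs ?K ?K w. c (fst p) \<otimes> coarse.T (fst p) (Cunit h (snd p)))"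
    using C_mult[OF c E K[OF c] K[OF E]] .
  also have "\<dots> = c (fst (w, (fst w, fst w))) \<otimes>
      coarse.T (fst (w, (fst w, fst w))) (Cunit h (snd (w, (fst w, fst w))))"
  proof (rule finsum_single[OF fin])
    fix p assume p: "p \<in> coarse.pairs ?K ?K w" "p \<noteq> (w, (fst w, fst w))"
    then have "Cunit h (snd p) = \<zero>" unfolding pairs by (auto simp: Cunit_def prod_eq_iff)
    then show "c (fst p) \<otimes> coarse.T (fst p) (Cunit h (snd p)) = \<zero>"
      using p cA by (simp add: pairs coarse.twist_zero)
  qed (use w wo in \<open>simp_all add: pairs mor_coarse m_closed coarse.twist_closed C_coeff(2) c E\<close>)
  also have "\<dots> = c w \<otimes> T (spread x w) (e (spread h (fst w, fst w)))"
    using w wo EA h by (simp add: twist_coarse Cunit_def mor_coarse e_closed spread)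
  also have "T (spread x w) (e (spread h (fst w, fst w))) = e (spread h w)"
    using T_spread_e[OF h w, of "(fst w, fst w)"] wo by (simp add: mor_coarse)
  finally show "(c \<otimes>\<^bsub>C\<^esub> Cunit h) w = c w \<otimes> e (spread h w)" .
  have "(Cunit h \<otimes>\<^bsub>C\<^esub> c) w =
      (\<Oplus>p\<in>coarse.pairs ?K ?K w. Cunit h (fst p) \<otimes> coarse.T (fst p) (c (snd p)))"
    using C_mult[OF E c K[OF E] K[OF c]] .
  also have "\<dots> = Cunit h (fst ((snd w, snd w), w)) \<otimes>
      coarse.T (fst ((snd w, snd w), w)) (c (snd ((snd w, snd w), w)))"
  proof (rule finsum_single[OF fin])
    fix p assume p: "p \<in> coarse.pairs ?K ?K w" "p \<noteq> ((snd w, snd w), w)"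
    then have "Cunit h (fst p) = \<zero>" unfolding pairs by (auto simp: Cunit_def prod_eq_iff)
    then show "Cunit h (fst p) \<otimes> coarse.T (fst p) (c (snd p)) = \<zero>"
      using p cA by (simp add: pairs coarse.twist_closed)
  qed (use w wo in \<open>simp_all add: pairs mor_coarse m_closed coarse.twist_closed C_coeff(2) c E\<close>)
  also have "\<dots> = e (spread h (snd w, snd w)) \<otimes> T (snd w) (c w)"
    using w wo cA h by (simp add: twist_coarse Cunit_def mor_coarse spread_object)
  also have "T (snd w) (c w) = c w"
    using c w wo T_object[OF wo(2) cA] D_absorb[of "snd w"] objectD[OF wo(2)] by (simp add: C_carrier_iff)
  also have "e (spread h (snd w, snd w)) = e (spread h w)"
    using D_spread_snd[OF h, of "(snd w, snd w)" w] w wo by (simp add: mor_coarse)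
  also have "e (spread h w) \<otimes> c w = c w \<otimes> e (spread h w)" using e_comm[OF _ cA] spread[OF h w] by simp
  finally show "(Cunit h \<otimes>\<^bsub>C\<^esub> c) w = c w \<otimes> e (spread h w)" .
qed

lemma Cdom_absorb:
  assumes h: "h \<in> mor H" and c: "c \<in> Cdom h"
  shows "c \<otimes>\<^bsub>C\<^esub> Cunit h = c"
proof
  fix w
  have cC: "c \<in> carrier C" and EC: "Cunit h \<in> carrier C"
    using c Cunit_closed[OF h] by (simp_all add: Cdom_iff[OF h])
  show "(c \<otimes>\<^bsub>C\<^esub> Cunit h) w = c w"
  proof (cases "w \<in> mor (coarse G)")
    case True
    then show ?thesis using Cunit_mult(1)[OF h cC True] c D_absorb spread h by (simp add: Cdom_iff)
  next
    case False
    then show ?thesis using C_coeff(4)[OF C_mult_closed[OF cC EC]] C_coeff(4)[OF cC] by simp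
  qed
qed

text \<open>The two formulas of \<open>Cunit_mult\<close> agree, which is centrality, and they cut
  each coefficient down to \<open>D (spread h u)\<close>. Knowing the generator evaluates
  \<open>ideal_unit\<close> in the product of the iterated ring.\<close>

lemma Cdom_generated:
  assumes h: "h \<in> mor H"
  shows "generated_by_idempotent C (Cdom h) (Cunit h)"
  unfolding generated_by_idempotent_def central_idempotent_def
proof (intro conjI ballI)
  show EC: "Cunit h \<in> carrier C" using Cunit_closed[OF h] Cdom_iff[OF h] by blast
  show "Cunit h \<otimes>\<^bsub>C\<^esub> Cunit h = Cunit h" using Cdom_absorb Cunit_closed h by blast
  show "c \<otimes>\<^bsub>C\<^esub> Cunit h = Cunit h \<otimes>\<^bsub>C\<^esub> c" if c: "c \<in> carrier C" for c
  proof
    fix w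
    show "(c \<otimes>\<^bsub>C\<^esub> Cunit h) w = (Cunit h \<otimes>\<^bsub>C\<^esub> c) w"
      using Cunit_mult[OF h c, of w] C_coeff(4)[OF C_mult_closed[OF c EC], of w]
        C_coeff(4)[OF C_mult_closed[OF EC c], of w]
      by (cases "w \<in> mor (coarse G)") simp_all
  qed
  have "c \<otimes>\<^bsub>C\<^esub> Cunit h \<in> Cdom h" if c: "c \<in> carrier C" for c
    unfolding Cdom_iff[OF h]
    using C_mult_closed[OF c EC] Cunit_mult(1)[OF h c] D_m_left D_e spread[OF h] C_coeff(2)[OF c]
    by simp
  moreover have "c \<in> carrier C" if "c \<in> Cdom h" for c using that Cdom_iff[OF h] by blast
  ultimately show "Cdom h = (\<lambda>c. c \<otimes>\<^bsub>C\<^esub> Cunit h) ` carrier C"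
    using Cdom_absorb[OF h] by (force simp: image_iff)
qed

lemma ideal_unit_Cdom: "h \<in> mor H \<Longrightarrow> ideal_unit C (Cdom h) = Cunit h"
  using ideal_unit_eqI[OF _ Cdom_generated] coarse.nonunital_ring_S unfolding C_eq by blast

text \<open>After the cut-off by the unit, every map in the chain defining \<gamma> is applied
  inside its domain and may be replaced by its total version \<open>T\<close>. The chain then
  collapses to the conjugate of \<open>h\<close> by the transversal element at
  \<open>snd u\<close>.\<close>

lemma twist_gamma:
  assumes h: "h \<in> mor H" and c: "c \<in> carrier C"
  shows "twist H C Cdom \<gamma> h c =
    (\<lambda>u. if u \<in> mor (coarse G) then T (spread h (snd u, snd u)) (c u) else \<zero>)"
proof
  fix u
  show "twist H C Cdom \<gamma> h c u = (if u \<in> mor (coarse G) then T (spread h (snd u, snd u)) (c u) else \<zero>)"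
  proof (cases "u \<in> mor (coarse G)")
    case u: True
    let ?t = "\<tau> (snd u)" and ?s = "(snd u, snd u)"
    have uo: "snd u \<in> objects G" and s: "?s \<in> mor (coarse G)" using u by (simp_all add: mor_coarse)
    note t = tau[OF uo]
    have hG: "h \<in> mor G" "src G h = x" "tgt G h = x" using h by (simp_all add: mor_H)
    have ih: "ginv G h \<in> mor H" using H_ginv h .
    let ?b = "c u \<otimes> e (spread (ginv G h) u)"
    have b: "?b \<in> D (spread (ginv G h) u)"
      using D_m_left D_e spread[OF ih u] C_coeff(2)[OF c] by blast
    then have bA: "?b \<in> carrier A" using D_carrier spread[OF ih u] by blast
    have bt: "?b \<in> D ?t" using D_spread_snd_object[OF ih u b] t by simp
    have "twist H C Cdom \<gamma> h c u = \<alpha> ?t (\<alpha> h (\<alpha> (ginv G ?t) ?b))"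
      using u h c ih by (simp add: twist_def gamma_def ginv_H ideal_unit_Cdom Cunit_mult)
    also have "\<alpha> (ginv G ?t) ?b = T (ginv G ?t) ?b"
      using bt t by (intro T_eq_alpha[symmetric]) (simp_all add: ginv ginv_ginv)
    also have "\<alpha> h (T (ginv G ?t) ?b) = T h (T (ginv G ?t) ?b)"
    proof (rule T_eq_alpha[symmetric, OF hG(1)])
      \<comment> \<open>By \<open>D_spread\<close>, \<open>?b\<close> lies in
        \<open>D (?t \<bullet> ginv G h)\<close>; moving it back along \<open>?t\<close> lands in
        the domain of \<open>\<alpha> h\<close>.\<close>
      have "T (ginv G ?t) ?b \<in> D (ginv G ?t \<bullet> (?t \<bullet> ginv G h))"
        using b t hG unfolding D_spread(1)[OF ih u]
        by (intro T_in_D_cmp) (simp_all add: ginv cmp_closed tgt_cmp)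
      then show "T (ginv G ?t) ?b \<in> D (ginv G h)" using t hG by (simp add: ginv_cmp_cancel ginv)
    qed
    also have "\<alpha> ?t (T h (T (ginv G ?t) ?b)) = T ?t (T h (T (ginv G ?t) ?b))"
      using D_tgt[OF hG(1) T_closed[OF hG(1) T_carrier[OF _ bA]], of "ginv G ?t"] t hG
      by (intro T_eq_alpha[symmetric]) (simp_all add: ginv)
    also have "T h (T (ginv G ?t) ?b) = T (h \<bullet> ginv G ?t) ?b"
    proof -
      have ht: "h \<bullet> ginv G ?t \<in> mor G" using t hG by (simp add: ginv cmp_closed)
      \<comment> \<open>The inverse transversal element has full domain, so the factor
        \<open>e h\<close> produced by \<open>T_T\<close> is absorbed.\<close>
      have "D (h \<bullet> ginv G ?t) = D h" using t hG by (intro D_cmp_full) (simp_all add: ginv ginv_ginv)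
      then have "T (h \<bullet> ginv G ?t) ?b \<in> D h" using T_closed[OF ht bA] by simp
      then show ?thesis using T_T[OF hG(1) _ _ bA, of "ginv G ?t"] D_absorb_left[OF hG(1)] t hG
        by (simp add: ginv)
    qed
    also have "T ?t (T (h \<bullet> ginv G ?t) ?b) = T (spread h ?s) ?b"
      using T_T_full[of ?t "h \<bullet> ginv G ?t" ?b] t hG bA
      by (simp add: spread_def ginv cmp_closed tgt_cmp cmp_assoc)
    \<comment> \<open>Both morphisms have isotropy part \<open>ginv G h\<close> and target
      \<open>snd u\<close>, so the unit coming from \<open>Cunit\<close> is the cut-off already
      contained in \<open>T (spread h ?s)\<close>.\<close>
    also have "e (spread (ginv G h) u) = e (ginv G (spread h ?s))"
      using D_spread_snd[OF ih u s] by (simp add: ginv_spread h s)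
    also have "T (spread h ?s) (c u \<otimes> e (ginv G (spread h ?s))) = T (spread h ?s) (c u)"
      using T_absorb[OF spread_closed[OF h s] C_coeff(2)[OF c]] .
    finally show ?thesis using u by simp
  qed (simp add: twist_def gamma_def)
qed

lemma twist_gamma_closed:
  assumes h: "h \<in> mor H" and c: "c \<in> carrier C"
  shows "twist H C Cdom \<gamma> h c \<in> carrier C"
  unfolding twist_gamma[OF h c] C_carrier_iff
  using D_spread_snd_object[OF h _ T_closed[OF spread_closed[OF h] C_coeff(2)[OF c]]]
  by (auto simp: mor_coarse)

end

section \<open>The isomorphism\<close>

text \<open>Every element of \<open>S\<close> is some \<open>f a\<close>, so the laws of
  \<open>S\<close> are images of those of \<open>R\<close>. This gives associativity of the iterated
  skew ring without examining \<gamma> further. The record field \<open>zero\<close> of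
  \<open>S\<close> is tied to \<open>f\<close> by its own hypothesis.\<close>

lemma nonunital_ring_isomorphicI:
  assumes R: "nonunital_ring R" and bij: "bij_betw f (carrier R) (carrier S)"
    and add: "\<And>a b. \<lbrakk>a \<in> carrier R; b \<in> carrier R\<rbrakk> \<Longrightarrow> f (a \<oplus>\<^bsub>R\<^esub> b) = f a \<oplus>\<^bsub>S\<^esub> f b"
    and mult: "\<And>a b. \<lbrakk>a \<in> carrier R; b \<in> carrier R\<rbrakk> \<Longrightarrow> f (a \<otimes>\<^bsub>R\<^esub> b) = f a \<otimes>\<^bsub>S\<^esub> f b"
    and zero: "f \<zero>\<^bsub>R\<^esub> = \<zero>\<^bsub>S\<^esub>"
  shows "nonunital_ring_isomorphic R S"
proof -
  interpret R: nonunital_ring R by fact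
  have S: "carrier S = f ` carrier R" using bij by (simp add: bij_betw_def)
  have S_ex: "\<exists>a\<in>carrier R. y = f a" if "y \<in> carrier S" for y using that S by blast
  have fS: "f a \<in> carrier S" if "a \<in> carrier R" for a using that S by blast
  note hom = add[symmetric] mult[symmetric] zero[symmetric] R.m_closed R.m_assoc R.l_distr R.r_distr R.a_assoc
  have "abelian_group S"
  proof (rule abelian_groupI)
    fix y assume "y \<in> carrier S"
    then obtain a where a: "a \<in> carrier R" "y = f a" using S_ex by blast
    then have "f (\<ominus>\<^bsub>R\<^esub> a) \<oplus>\<^bsub>S\<^esub> y = \<zero>\<^bsub>S\<^esub>" by (simp add: hom R.l_neg)
    then show "\<exists>z\<in>carrier S. z \<oplus>\<^bsub>S\<^esub> y = \<zero>\<^bsub>S\<^esub>" using a fS by blast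
  next
    fix y z assume "y \<in> carrier S" "z \<in> carrier S"
    then obtain a b where "a \<in> carrier R" "y = f a" "b \<in> carrier R" "z = f b" using S_ex by blast
    then show "y \<oplus>\<^bsub>S\<^esub> z = z \<oplus>\<^bsub>S\<^esub> y" by (simp add: hom R.a_comm)
  qed (auto dest!: S_ex simp: hom fS)
  moreover have "nonunital_ring_axioms S"
    by (rule nonunital_ring_axioms.intro) (auto dest!: S_ex simp: hom fS)
  ultimately have "nonunital_ring S" by (rule nonunital_ring.intro)
  moreover have "f \<in> nonunital_ring_iso R S"
    using bij fS by (auto simp: nonunital_ring_iso_def iso_def hom_def add mult)
  ultimately show ?thesis using R unfolding nonunital_ring_isomorphic_def by blast
qed

section \<open>Regrouping coefficients by isotropy part and ends\<close>

context group_type_action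
begin

abbreviation S where "S \<equiv> skew_groupoid_ring G A D \<alpha>"
abbreviation R where "R \<equiv> skew_groupoid_ring H C Cdom \<gamma>"

text \<open>The default serves at both levels: a row outside the isotropy group is the zero of
  \<open>C\<close>, and an entry outside the coarse groupoid is the zero of \<open>A\<close>, as the
  two carriers demand.\<close>

definition regroup :: "('g \<Rightarrow> 'a) \<Rightarrow> 'g \<Rightarrow> 'g \<times> 'g \<Rightarrow> 'a" where
  "regroup a h u = (if h \<in> mor H \<and> u \<in> mor (coarse G) then a (spread h u) else \<zero>)"

definition ungroup :: "('g \<Rightarrow> 'g \<times> 'g \<Rightarrow> 'a) \<Rightarrow> 'g \<Rightarrow> 'a" where
  "ungroup c g = (if g \<in> mor G then c (core g) (src G g, tgt G g) else \<zero>)"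

lemma R_carrier: "c \<in> carrier R \<longleftrightarrow>
    (\<forall>h\<in>mor H. c h \<in> Cdom h) \<and> (\<forall>h. h \<notin> mor H \<longrightarrow> c h = \<zero>\<^bsub>C\<^esub>) \<and> finite (supp C c)"
  by (simp add: skew_groupoid_ring_def)

lemma regroup_coeff:
  assumes a: "a \<in> carrier S" and h: "h \<in> mor H"
  shows "regroup a h \<in> Cdom h" and "regroup a h \<in> carrier C"
proof -
  have "regroup a h u \<in> D (spread h u)" if "u \<in> mor (coarse G)" for u
    using skew.S_coeff(1)[OF a spread_closed[OF h that]] h that by (simp add: regroup_def)
  then have "regroup a h \<in> carrier C \<and> (\<forall>u\<in>mor (coarse G). regroup a h u \<in> D (spread h u))"
    unfolding C_carrier_iff using D_spread_snd_object[OF h] by (auto simp: regroup_def)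
  then show "regroup a h \<in> Cdom h" "regroup a h \<in> carrier C" using Cdom_iff[OF h] by blast+
qed

lemma regroup_closed:
  assumes a: "a \<in> carrier S"
  shows "regroup a \<in> carrier R"
  unfolding R_carrier
proof (intro conjI)
  \<comment> \<open>A nonzero row at \<open>h\<close> has a nonzero entry
    \<open>a (spread h u)\<close>, and \<open>core\<close> recovers \<open>h\<close> from
    \<open>spread h u\<close>; hence only finitely many rows are nonzero.\<close>
  have "supp C (regroup a) \<subseteq> core ` supp A a"
  proof
    fix h assume "h \<in> supp C (regroup a)"
    then obtain u where "regroup a h u \<noteq> \<zero>" unfolding C_zero by (auto simp: fun_eq_iff)
    then have "h \<in> mor H" "u \<in> mor (coarse G)" "a (spread h u) \<noteq> \<zero>"
      unfolding regroup_def by presburger+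
    then show "h \<in> core ` supp A a"
      using core_spread[of h u] by (intro image_eqI[of _ _ "spread h u"]) simp_all
  qed
  then show "finite (supp C (regroup a))" using skew.S_coeff(5)[OF a] by (rule finite_surj[rotated])
qed (use regroup_coeff[OF a] in \<open>auto simp: regroup_def C_zero\<close>)

lemma ungroup_closed:
  assumes c: "c \<in> carrier R"
  shows "ungroup c \<in> carrier S"
  unfolding skew.S_carrier
proof (intro conjI)
  have coeff: "c h u \<in> D (spread h u)" if "h \<in> mor H" "u \<in> mor (coarse G)" for h u
    using c that Cdom_iff unfolding R_carrier by blast
  show "\<forall>g\<in>mor G. ungroup c g \<in> D g"
  proof
    fix g assume g: "g \<in> mor G"
    show "ungroup c g \<in> D g"
      using coeff[OF core_closed[OF g] ends_closed[OF g]] g by (simp add: spread_core ungroup_def)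
  qed
  show "\<forall>g. g \<notin> mor G \<longrightarrow> ungroup c g = \<zero>" by (simp add: ungroup_def)
  \<comment> \<open>Finitely many rows are nonzero, and each has finitely many entries because there
    are finitely many objects.\<close>
  have "supp A (ungroup c) \<subseteq> (\<lambda>(h, u). spread h u) ` (supp C c \<times> mor (coarse G))"
  proof
    fix g assume "g \<in> supp A (ungroup c)"
    then have g: "g \<in> mor G" "c (core g) (src G g, tgt G g) \<noteq> \<zero>"
      unfolding ungroup_def by (auto split: if_splits)
    then show "g \<in> (\<lambda>(h, u). spread h u) ` (supp C c \<times> mor (coarse G))"
      using spread_core[OF g(1)] ends_closed[OF g(1)]
      by (intro image_eqI[of _ _ "(core g, (src G g, tgt G g))"]) (auto simp: C_zero)
  qed
  moreover have "finite (supp C c \<times> mor (coarse G))"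
    using c finite_coarse unfolding R_carrier by blast
  ultimately show "finite (supp A (ungroup c))" by (rule finite_surj[rotated])
qed

lemma regroup_bij: "bij_betw regroup (carrier S) (carrier R)"
proof (rule bij_betw_byWitness[where f' = ungroup])
  show "\<forall>a\<in>carrier S. ungroup (regroup a) = a"
    using skew.S_coeff(4)
    by (auto simp: fun_eq_iff ungroup_def regroup_def core_closed ends_closed spread_core)
  show "\<forall>c\<in>carrier R. regroup (ungroup c) = c"
  proof (intro ballI ext)
    fix c h u assume c: "c \<in> carrier R"
    have "c h u = \<zero>" if "h \<notin> mor H \<or> u \<notin> mor (coarse G)"
    proof (cases "h \<in> mor H")
      case True
      then have "c h \<in> carrier C" using c Cdom_iff unfolding R_carrier by blast
      then show ?thesis using that True C_coeff(4) by blast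
    next
      case False
      then show ?thesis using c unfolding R_carrier by (simp add: C_zero)
    qed
    then show "regroup (ungroup c) h u = c h u"
      by (auto simp: regroup_def ungroup_def spread core_spread)
  qed
qed (use regroup_closed ungroup_closed in auto)

section \<open>Compatibility with sums and products\<close>

lemma regroup_add: "regroup (a \<oplus>\<^bsub>S\<^esub> b) = regroup a \<oplus>\<^bsub>R\<^esub> regroup b"
  by (auto simp: fun_eq_iff regroup_def skew_groupoid_ring_def coarse_skew_ring_def)

lemma regroup_zero: "regroup \<zero>\<^bsub>S\<^esub> = \<zero>\<^bsub>R\<^esub>"
  by (auto simp: fun_eq_iff regroup_def skew_groupoid_ring_def coarse_skew_ring_def)

lemma regroup_coeff_mult:
  assumes a: "a \<in> carrier S" and b: "b \<in> carrier S" and g: "g \<in> mor H" and h: "h \<in> mor H"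
  shows "(regroup a g \<otimes>\<^bsub>C\<^esub> twist H C Cdom \<gamma> g (regroup b h)) w =
    (\<Oplus>p\<in>coarse.pairs (supp A (regroup a g)) (supp A (regroup b h)) w.
        a (spread g (fst p)) \<otimes> T (spread g (fst p)) (b (spread h (snd p))))"
proof -
  let ?c = "regroup a g" and ?d = "regroup b h"
  let ?d' = "twist H C Cdom \<gamma> g ?d"
  have c: "?c \<in> carrier C" and d: "?d \<in> carrier C" using regroup_coeff a b g h by auto
  have d': "?d' \<in> carrier C" using twist_gamma_closed[OF g d] .
  have d'_eq: "?d' u = (if u \<in> mor (coarse G) then T (spread g (snd u, snd u)) (?d u) else \<zero>)" for u
    unfolding twist_gamma[OF g d] ..
  have X: "finite (supp A ?c)" "supp A ?c \<subseteq> mor (coarse G)"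
    and Y: "finite (supp A ?d)" "supp A ?d \<subseteq> mor (coarse G)"
    using C_coeff(3,5)[OF c] C_coeff(3,5)[OF d] by blast+
  \<comment> \<open>The twist may annihilate coefficients, so the pairs are indexed by the support
    of \<open>?d\<close>, as \<open>C_mult\<close> allows.\<close>
  have "supp A ?d' \<subseteq> supp A ?d"
    using skew.twist_zero[OF spread_closed[OF g]] by (auto simp: d'_eq mor_coarse split: if_splits)
  then have "(?c \<otimes>\<^bsub>C\<^esub> ?d') w =
      (\<Oplus>p\<in>coarse.pairs (supp A ?c) (supp A ?d) w. ?c (fst p) \<otimes> coarse.T (fst p) (?d' (snd p)))"
    using C_mult[OF c d' X order_refl Y] by blast
  also have "\<dots> = (\<Oplus>p\<in>coarse.pairs (supp A ?c) (supp A ?d) w.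
        a (spread g (fst p)) \<otimes> T (spread g (fst p)) (b (spread h (snd p))))"
  proof (rule finsum_cong'[OF refl])
    show "(\<lambda>p. a (spread g (fst p)) \<otimes> T (spread g (fst p)) (b (spread h (snd p))))
        \<in> coarse.pairs (supp A ?c) (supp A ?d) w \<rightarrow> carrier A"
    proof
      fix p assume "p \<in> coarse.pairs (supp A ?c) (supp A ?d) w"
      then have "fst p \<in> mor (coarse G)" using X by (auto simp: coarse_pairs)
      then show "a (spread g (fst p)) \<otimes> T (spread g (fst p)) (b (spread h (snd p))) \<in> carrier A"
        using skew.S_mult_term[OF a b] spread_closed[OF g] by blast
    qed
    fix p assume p: "p \<in> coarse.pairs (supp A ?c) (supp A ?d) w"
    obtain u v where uv: "p = (u, v)" by (cases p)
    have u: "u \<in> mor (coarse G)" and v: "v \<in> mor (coarse G)" and fs: "fst u = snd v"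
      using p X Y unfolding uv coarse_pairs by auto
    have bA: "b (spread h v) \<in> carrier A" using skew.S_coeff(2)[OF b] .
    have s: "(snd v, snd v) \<in> mor (coarse G)" using v by (simp add: mor_coarse)
    have "?c u \<otimes> coarse.T u (?d' v) = a (spread g u) \<otimes> T (spread x u) (T (spread g (snd v, snd v)) (b (spread h v)))"
      using u v g h s bA by (simp add: d'_eq regroup_def twist_coarse T_carrier spread)
    \<comment> \<open>The twist of \<beta> along \<open>u\<close> after the twist of \<gamma> by
      \<open>g\<close> is the twist of \<alpha> along \<open>spread g u\<close>.\<close>
    also have "T (spread x u) (T (spread g (snd v, snd v)) (b (spread h v))) = T (spread g u) (b (spread h v))"
      using T_spread_x[OF g u s _ bA] unfolding fs[symmetric] by simp
    finally show "?c (fst p) \<otimes> coarse.T (fst p) (?d' (snd p)) =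
        a (spread g (fst p)) \<otimes> T (spread g (fst p)) (b (spread h (snd p)))"
      by (simp add: uv)
  qed
  finally show ?thesis .
qed

lemma regroup_supp_iff: "regroup a h \<noteq> \<zero>\<^bsub>C\<^esub> \<and> u \<in> supp A (regroup a h) \<longleftrightarrow>
    h \<in> mor H \<and> u \<in> mor (coarse G) \<and> a (spread h u) \<noteq> \<zero>"
proof -
  have "regroup a h \<noteq> \<zero>\<^bsub>C\<^esub>" if "regroup a h u \<noteq> \<zero>" using that by (auto simp: C_zero)
  then show ?thesis by (auto simp: regroup_def[of a h u])
qed

text \<open>Both coefficients at \<open>k\<close>, \<open>w\<close> are sums of the same terms: one
  over pairs in \<open>G\<close> with product \<open>spread k w\<close>, the other over isotropy
  pairs with product \<open>k\<close> and coarse pairs with product \<open>w\<close>. Applying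
  \<open>spread\<close> to both members is a bijection between the index sets.\<close>

lemma regroup_mult:
  assumes a: "a \<in> carrier S" and b: "b \<in> carrier S"
  shows "regroup (a \<otimes>\<^bsub>S\<^esub> b) = regroup a \<otimes>\<^bsub>R\<^esub> regroup b"
proof (intro ext)
  fix k w
  let ?P = "{(g, h). g \<in> mor H \<and> h \<in> mor H \<and> regroup a g \<noteq> \<zero>\<^bsub>C\<^esub> \<and> regroup b h \<noteq> \<zero>\<^bsub>C\<^esub> \<and>
    src H g = tgt H h \<and> g \<cdot>\<^bsub>H\<^esub> h = k}"
  let ?J = "\<lambda>q. coarse.pairs (supp A (regroup a (fst q))) (supp A (regroup b (snd q))) w"
  let ?F = "\<lambda>q p. a (spread (fst q) (fst p)) \<otimes> T (spread (fst q) (fst p)) (b (spread (snd q) (snd p)))"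
  let ?f = "\<lambda>(q, p). (spread (fst q) (fst p), spread (snd q) (snd p))"
  have P: "fst q \<in> mor H" "snd q \<in> mor H" if "q \<in> ?P" for q using that by auto
  have finP: "finite ?P"
    by (rule finite_subset[of _ "supp C (regroup a) \<times> supp C (regroup b)"])
      (use regroup_closed[OF a] regroup_closed[OF b] in \<open>auto simp: R_carrier\<close>)
  have J: "fst p \<in> mor (coarse G)" "snd p \<in> mor (coarse G)" if "q \<in> ?P" "p \<in> ?J q" for p q
    using that by (auto simp: coarse_pairs regroup_def split: if_splits)
  have finJ: "finite (?J q)" if "q \<in> ?P" for q
    using P[OF that] C_coeff(5) regroup_coeff(2) a b by (intro coarse.finite_pairs) auto
  have FA: "?F q p \<in> carrier A" if "q \<in> ?P" "p \<in> ?J q" for q p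
    using skew.S_mult_term[OF a b] spread_closed[OF P(1)[OF that(1)] J(1)[OF that]] by blast
  have "(regroup a \<otimes>\<^bsub>R\<^esub> regroup b) k w =
      (\<Oplus>\<^bsub>C\<^esub>q\<in>?P. regroup a (fst q) \<otimes>\<^bsub>C\<^esub> twist H C Cdom \<gamma> (fst q) (regroup b (snd q))) w"
    by (simp add: skew_groupoid_ring_def[of H] twist_def) (simp only: split_def)
  also have "\<dots> = (\<Oplus>q\<in>?P. (regroup a (fst q) \<otimes>\<^bsub>C\<^esub> twist H C Cdom \<gamma> (fst q) (regroup b (snd q))) w)"
    using P a b by (intro coarse.finsum_S_apply[unfolded C_eq] C_mult_closed twist_gamma_closed regroup_coeff(2))
  also have "\<dots> = (\<Oplus>q\<in>?P. \<Oplus>p\<in>?J q. ?F q p)"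
    using P FA regroup_coeff_mult[OF a b] by (intro finsum_cong') (auto intro!: finsum_closed)
  also have "\<dots> = (\<Oplus>r\<in>Sigma ?P ?J. ?F (fst r) (snd r))"
    using finP finJ FA by (intro finsum_Sigma) auto
  finally have rhs: "(regroup a \<otimes>\<^bsub>R\<^esub> regroup b) k w = (\<Oplus>r\<in>Sigma ?P ?J. ?F (fst r) (snd r))" .
  have Sigma_iff: "((g, h), (u, v)) \<in> Sigma ?P ?J \<longleftrightarrow>
      g \<in> mor H \<and> h \<in> mor H \<and> u \<in> mor (coarse G) \<and> v \<in> mor (coarse G) \<and>
      a (spread g u) \<noteq> \<zero> \<and> b (spread h v) \<noteq> \<zero> \<and> fst u = snd v \<and> g \<bullet> h = k \<and> (fst v, snd u) = w" for g h u v
    using regroup_supp_iff[of a g u] regroup_supp_iff[of b h v]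
    by (auto simp: coarse_pairs H_simps mor_H)
  show "regroup (a \<otimes>\<^bsub>S\<^esub> b) k w = (regroup a \<otimes>\<^bsub>R\<^esub> regroup b) k w"
  proof (cases "k \<in> mor H \<and> w \<in> mor (coarse G)")
    case False
    \<comment> \<open>Products stay in the isotropy group and in the coarse groupoid, so outside
      them no pair contributes and both sides are zero.\<close>
    have "((g, h), (u, v)) \<notin> Sigma ?P ?J" for g h u v
      unfolding Sigma_iff using False H_cmp by (auto simp: mor_coarse)
    then have "((fst (fst r), snd (fst r)), (fst (snd r), snd (snd r))) \<notin> Sigma ?P ?J" for r .
    then have "r \<notin> Sigma ?P ?J" for r unfolding prod.collapse .
    then have "Sigma ?P ?J = {}" by (meson ex_in_conv)
    moreover have "regroup (a \<otimes>\<^bsub>S\<^esub> b) k w = \<zero>" unfolding regroup_def using False by presburger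
    ultimately show ?thesis unfolding rhs by (simp only: finsum_empty)
  next
    case True
    let ?Q = "skew.pairs (supp A a) (supp A b) (spread k w)"
    have inj: "inj_on ?f (Sigma ?P ?J)"
    proof (rule inj_onI)
      fix r r' assume r: "r \<in> Sigma ?P ?J" "r' \<in> Sigma ?P ?J" and eq: "?f r = ?f r'"
      obtain g h u v g' h' u' v' where rr: "r = ((g, h), (u, v))" "r' = ((g', h'), (u', v'))"
        by (cases r, cases r') fastforce
      show "r = r'"
        using r eq spread_inj[of g u g' u'] spread_inj[of h v h' v'] unfolding rr Sigma_iff by simp
    qed
    have img: "?f ` Sigma ?P ?J = ?Q"
    proof (intro equalityI subsetI)
      fix m assume "m \<in> ?f ` Sigma ?P ?J"
      then obtain g h u v where r: "((g, h), (u, v)) \<in> Sigma ?P ?J" and m: "m = (spread g u, spread h v)"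
        unfolding image_iff by (metis (no_types, lifting) case_prod_conv fst_conv snd_conv surj_pair)
      then show "m \<in> ?Q" unfolding Sigma_iff by (auto simp: skew.pairs_def spread spread_cmp)
    next
      fix m assume "m \<in> ?Q"
      then obtain g h where m: "m = (g, h)" "a g \<noteq> \<zero>" "b h \<noteq> \<zero>" "src G g = tgt G h" "g \<bullet> h = spread k w"
        by (auto simp: skew.pairs_def)
      have gh: "g \<in> mor G" "h \<in> mor G" using m skew.S_coeff(3) a b by auto
      let ?u = "(src G g, tgt G g)" and ?v = "(src G h, tgt G h)"
      note spread_gh = spread_core[OF gh(1)] spread_core[OF gh(2)]
      \<comment> \<open>The preimage of a composable pair is formed from the cores and ends of its
        members. Multiplying the decompositions and comparing with \<open>spread k w\<close> shows,
        by uniqueness, that it belongs to \<open>k\<close> and \<open>w\<close>.\<close>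
      have "spread (core g) ?u \<bullet> spread (core h) ?v = spread (core g \<bullet> core h) (fst ?v, snd ?u)"
        using m(4) by (intro spread_cmp core_closed ends_closed gh) simp
      then have "spread (core g \<bullet> core h) (fst ?v, snd ?u) = spread k w"
        unfolding spread_gh m(5) by simp
      moreover have "(fst ?v, snd ?u) \<in> mor (coarse G)"
        using gh by (simp add: mor_coarse src_in_objects tgt_in_objects)
      ultimately have "core g \<bullet> core h = k \<and> (fst ?v, snd ?u) = w"
        using spread_inj True H_cmp core_closed gh by metis
      then have "((core g, core h), (?u, ?v)) \<in> Sigma ?P ?J"
        unfolding Sigma_iff spread_gh using gh m(2-4) ends_closed[OF gh(1)] by (simp add: core_closed ends_closed)
      then show "m \<in> ?f ` Sigma ?P ?J"
        by (intro image_eqI[of _ _ "((core g, core h), (?u, ?v))"]) (simp_all only: m(1) spread_gh split_conv fst_conv snd_conv)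
    qed
    have "regroup (a \<otimes>\<^bsub>S\<^esub> b) k w = (a \<otimes>\<^bsub>S\<^esub> b) (spread k w)" using True by (simp add: regroup_def)
    also have "\<dots> = (\<Oplus>m\<in>?Q. a (fst m) \<otimes> T (fst m) (b (snd m)))"
      by (rule skew.S_mult[OF a b skew.S_coeff(5)[OF a] skew.supp_subset[OF a] order_refl
          skew.S_coeff(5)[OF b] skew.supp_subset[OF b] order_refl])
    also have "\<dots> = (\<Oplus>r\<in>Sigma ?P ?J. a (fst (?f r)) \<otimes> T (fst (?f r)) (b (snd (?f r))))"
      unfolding img[symmetric]
    proof (rule finsum_reindex[OF _ inj])
      have "a (fst m) \<otimes> T (fst m) (b (snd m)) \<in> carrier A" if "m \<in> ?Q" for m
        using that skew.supp_subset[OF a] skew.S_mult_term[OF a b] by (auto simp: skew.pairs_def)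
      then show "(\<lambda>m. a (fst m) \<otimes> T (fst m) (b (snd m))) \<in> ?f ` Sigma ?P ?J \<rightarrow> carrier A"
        unfolding img by blast
    qed
    also have "\<dots> = (regroup a \<otimes>\<^bsub>R\<^esub> regroup b) k w" unfolding rhs by (simp add: split_def)
    finally show ?thesis .
  qed
qed

lemma skew_ring_isomorphic: "nonunital_ring_isomorphic S R"
  by (intro nonunital_ring_isomorphicI[of _ regroup] skew.nonunital_ring_S regroup_bij regroup_add
      regroup_mult regroup_zero)

end

theorem theorem4p4:
  fixes G :: "('g, 'm) groupoid_scheme" and A :: "('a, 'n) ring_scheme"
    and D :: "'g \<Rightarrow> 'a set" and \<alpha> :: "'g \<Rightarrow> 'a \<Rightarrow> 'a" and x :: 'g and \<tau> :: "'g \<Rightarrow> 'g"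
  assumes "connected_groupoid G"
    and "finite (objects G)"
    and "x \<in> objects G"
    and "unital_partial_action G A D \<alpha>"
    and "internal_direct_sum A (objects G) D"
    and "group_type G D"
    and "full_transversal G D x \<tau>"
  shows "nonunital_ring_isomorphic
           (skew_groupoid_ring G A D \<alpha>)
           (skew_groupoid_ring (isotropy G x) (coarse_skew_ring G A D \<alpha> \<tau>)
              (gamma_dom G A D \<alpha> \<tau>) (gamma G A \<alpha> \<tau>))"
proof -
  interpret group_type_action A G D \<alpha> x \<tau>
    using assms by (intro group_type_action.intro unital_action.intro group_type_action_axioms.intro)
  show ?thesis by (rule skew_ring_isomorphic)
qed

end
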